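(* Let $(\mathcal{X},\mathcal{Y},\{W(y|x):x\in\mathcal{X},y\in\mathcal{Y}\})$ be a discrete memoryless channel with capacity $C$ and channel dispersion $\nu>0$, and let $T$ be a positive integer. For $0<t<\frac12$, there exists a sequence of $(n,M_n,\epsilon_n,T,S_n)$-streaming codes such that $\log M_n=nC-n^{1-t}$, $S_n=\exp\{o(n^{1-2t})\}$, and $\epsilon_n$ satisfies $$\liminf_{n\to\infty}-\frac{1}{n^{1-2t}}\log\epsilon_n\ge\frac{T}{2\nu}.$$
   Context: Conventions: all logs are to base 2. $[i:j]=\{i,i+1,\dots,j\}$; $x^j=(x_1,\dots,x_j)$. Asymptotic notation $o(\cdot)$ is the usual one, with the additional restriction that the sequences in it are positive (the base of $\exp$ is immaterial here). Channel: $\mathcal{X},\mathcal{Y}$ are finite sets and $W(\cdot|x)$ is a probability distribution on $\mathcal{Y}$ for each $x\in\mathcal{X}$. Channel uses are memoryless, without feedback. For a distribution $P$ on $\mathcal{X}$, let $PW(y)=\sum_x P(x)W(y|x)$, $i(x;y)=\log\frac{W(y|x)}{PW(y)}$, $I(P,W)=\sum_{x,y}P(x)W(y|x)\,i(x;y)$, and $V(P,W)=\mathrm{E}[\mathrm{Var}[i(X;Y)|X]]$ with $X\sim P$, $Y|X\sim W$. Capacity: $C=\max_P I(P,W)$. Dispersion: $\nu=\min_{P:I(P,W)=C}V(P,W)$. Streaming code: an $(n,M,\epsilon,T,S)$-streaming code consists of (i) independent messages $G_1,\dots,G_S$, each uniform on $\mathcal{G}=[1:M]$; (ii) encoding functions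 $\phi_k:\mathcal{G}^{\min\{k,S\}}\to\mathcal{X}^n$, $k\in[1:S+T-1]$, giving the codeword $\mathbf{X}_k=\phi_k(G^{\min\{k,S\}})$ sent in block $k$ ($n$ channel uses), with output $\mathbf{Y}_k\in\mathcal{Y}^n$; (iii) decoding functions $\psi_k:\mathcal{Y}^{(k+T-1)n}\to\mathcal{G}$, $k\in[1:S]$, giving $\hat G_k=\psi_k(\mathbf{Y}_1,\dots,\mathbf{Y}_{k+T-1})$; such that $\max_{k\in[1:S]}\Pr(\hat G_k\ne G_k)\le\epsilon$. *)

theory Defs
  imports "HOL-Probability.Probability" "HOL-Library.Landau_Symbols"
begin

text \<open>
  A discrete memoryless channel is a family \<open>W :: 'x \<Rightarrow> 'y pmf\<close> over finite types. All logarithms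
  are to base 2.
\<close>

definition output_pmf :: "'x pmf \<Rightarrow> ('x::finite \<Rightarrow> 'y::finite pmf) \<Rightarrow> 'y pmf" where
  "output_pmf P W = bind_pmf P W"

text \<open>
  The library conventions \<open>log 2 0 = 0\<close> and \<open>a / 0 = 0\<close> are only relevant at pairs
  \<open>(x, y)\<close> with \<open>P(x) W(y|x) = 0\<close>, which contribute nothing to the quantities below.
\<close>

definition info_density :: "'x pmf \<Rightarrow> ('x::finite \<Rightarrow> 'y::finite pmf) \<Rightarrow> 'x \<Rightarrow> 'y \<Rightarrow> real" where
  "info_density P W x y = log 2 (pmf (W x) y / pmf (output_pmf P W) y)"

definition mutual_info :: "'x pmf \<Rightarrow> ('x::finite \<Rightarrow> 'y::finite pmf) \<Rightarrow> real" where
  "mutual_info P W = (\<Sum>x\<in>UNIV. \<Sum>y\<in>UNIV. pmf P x * pmf (W x) y * info_density P W x y)"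

definition cond_info_variance :: "'x pmf \<Rightarrow> ('x::finite \<Rightarrow> 'y::finite pmf) \<Rightarrow> real" where
  "cond_info_variance P W =
     measure_pmf.expectation P (\<lambda>x. measure_pmf.variance (W x) (info_density P W x))"

text \<open>
  By compactness of the probability simplex and continuity, the supremum and the infimum below are
  attained, i.e. they are a maximum and a minimum.
\<close>

definition capacity :: "('x::finite \<Rightarrow> 'y::finite pmf) \<Rightarrow> real" where
  "capacity W = (SUP P. mutual_info P W)"

definition dispersion :: "('x::finite \<Rightarrow> 'y::finite pmf) \<Rightarrow> real" where
  "dispersion W = (INF P\<in>{P. mutual_info P W = capacity W}. cond_info_variance P W)"

text \<open>
  A vector with components indexed by \<open>{1..m}\<close> is a function on \<open>nat\<close>
  that takes the value \<open>undefined\<close> outside \<open>{1..m}\<close>; the prefix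
  \<open>x\<^sup>j\<close> of such a vector is \<open>restrict x {1..j}\<close>.
\<close>

definition message_pmf :: "nat \<Rightarrow> nat \<Rightarrow> (nat \<Rightarrow> nat) pmf" where
  "message_pmf M S = Pi_pmf {1..S} undefined (\<lambda>_. pmf_of_set {1..M})"

definition block_channel ::
    "('x::finite \<Rightarrow> 'y::finite pmf) \<Rightarrow> nat \<Rightarrow> (nat \<Rightarrow> 'x) \<Rightarrow> (nat \<Rightarrow> 'y) pmf" where
  "block_channel W n x = Pi_pmf {1..n} undefined (\<lambda>i. W (x i))"

text \<open>
  \<open>\<phi> k g i\<close> is the \<open>i\<close>-th symbol of the codeword sent in block \<open>k\<close>, and
  \<open>\<psi> k y\<close> is the estimate of message \<open>k\<close> from the output blocks
  \<open>y 1, \<dots>, y (k + T - 1)\<close>.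
\<close>

type_synonym 'x stream_encoder = "nat \<Rightarrow> (nat \<Rightarrow> nat) \<Rightarrow> nat \<Rightarrow> 'x"
type_synonym 'y stream_decoder = "nat \<Rightarrow> (nat \<Rightarrow> nat \<Rightarrow> 'y) \<Rightarrow> nat"

definition stream_pmf ::
    "('x::finite \<Rightarrow> 'y::finite pmf) \<Rightarrow> nat \<Rightarrow> nat \<Rightarrow> nat \<Rightarrow> nat \<Rightarrow> 'x stream_encoder
      \<Rightarrow> ((nat \<Rightarrow> nat) \<times> (nat \<Rightarrow> nat \<Rightarrow> 'y)) pmf" where
  "stream_pmf W n M T S \<phi> =
     bind_pmf (message_pmf M S) (\<lambda>G.
       map_pmf (\<lambda>Y. (G, Y))
         (Pi_pmf {1..S + T - 1} undefined
           (\<lambda>k. block_channel W n (\<phi> k (restrict G {1..min k S})))))"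

definition stream_error ::
    "('x::finite \<Rightarrow> 'y::finite pmf) \<Rightarrow> nat \<Rightarrow> nat \<Rightarrow> nat \<Rightarrow> nat
      \<Rightarrow> 'x stream_encoder \<Rightarrow> 'y stream_decoder \<Rightarrow> nat \<Rightarrow> real" where
  "stream_error W n M T S \<phi> \<psi> k =
     measure_pmf.prob (stream_pmf W n M T S \<phi>) {(G, Y). \<psi> k (restrict Y {1..k + T - 1}) \<noteq> G k}"

text \<open>
  No side condition on \<open>\<phi>\<close> is needed: the codeword alphabet is a whole type, and only the
  symbols \<open>\<phi> k g i\<close> with \<open>i \<in> {1..n}\<close> and \<open>k \<in> {1..S + T - 1}\<close> are ever used.
\<close>

definition streaming_code ::
    "('x::finite \<Rightarrow> 'y::finite pmf) \<Rightarrow> nat \<Rightarrow> nat \<Rightarrow> real \<Rightarrow> nat \<Rightarrow> nat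
      \<Rightarrow> 'x stream_encoder \<Rightarrow> 'y stream_decoder \<Rightarrow> bool" where
  "streaming_code W n M \<epsilon> T S \<phi> \<psi> \<longleftrightarrow>
     n > 0 \<and> M > 0 \<and> T > 0 \<and> S > 0 \<and>
     (\<forall>k\<in>{1..S}. \<psi> k \<in> ({1..k + T - 1} \<rightarrow>\<^sub>E ({1..n} \<rightarrow>\<^sub>E UNIV)) \<rightarrow> {1..M}) \<and>
     (MAX k\<in>{1..S}. stream_error W n M T S \<phi> \<psi> k) \<le> \<epsilon>"

text \<open>
  The requirement \<open>log M = n C - n\<^bsup>1-t\<^esup>\<close> read for an integer \<open>M\<close>: rounding up makes the
  number of messages at least the prescribed one, and positive for every \<open>n\<close>.
\<close>

definition message_count :: "('x::finite \<Rightarrow> 'y::finite pmf) \<Rightarrow> real \<Rightarrow> nat \<Rightarrow> nat" where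
  "message_count W t n = nat \<lceil>2 powr (real n * capacity W - real n powr (1 - t))\<rceil>"

end

theory Submission
  imports Defs "HOL-Real_Asymp.Real_Asymp"
begin

text \<open>
  Fix a capacity-achieving input distribution \<open>P\<close> and draw, for every block and every message
  prefix known by then, a codeword with independent symbols from \<open>P\<close>. To estimate message \<open>k\<close>, the
  decoder takes any message sequence such that for every \<open>j \<le> k\<close> the information density accumulated
  over the blocks \<open>j, \<dots>, k + T - 1\<close> exceeds a threshold. A wrong estimate has a first wrong
  message \<open>j \<le> k\<close>, and from block \<open>j\<close> on its codewords are independent of the true ones. So
  the error event at \<open>j\<close> behaves as for a block code of \<open>L = k + T - j \<ge> T\<close> blocks and has
  probability at most \<open>2 c\<^sup>L\<close>; the geometric series in \<open>L\<close> is dominated by \<open>L = T\<close>. Summing over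
  \<open>k\<close> costs the subexponential factor \<open>S\<close> only.

  The factor \<open>c\<close> of a single block comes from a Chernoff bound with a second-order expansion of the
  exponential moment. At a capacity-achieving \<open>P\<close> the relative entropy between \<open>W x\<close> and the output
  distribution is \<open>C\<close> for every \<open>x\<close> in the support, so the variance of the information density
  is the conditional variance. Since the exponent is required in base \<open>2\<close>, there is a constant factor
  \<open>1 / ln 2\<close> to spare, so it suffices that the conditional variance of \<open>P\<close> is close to \<open>\<nu>\<close>.
\<close>

subsection \<open>Capacity-achieving input distributions\<close>

lemma pmf_output:
  "pmf (output_pmf P W) y = (\<Sum>x\<in>UNIV. pmf P x * pmf (W x) y)"
  unfolding output_pmf_def pmf_bind by (subst integral_measure_pmf_real[of UNIV]) (auto simp: mult.commute)

lemma sum_pmf_UNIV: "(\<Sum>x\<in>UNIV. pmf (p :: 'a::finite pmf) x) = 1"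
  by (simp add: sum_pmf_eq_1)

lemma pmf_output_pos:
  assumes "x \<in> set_pmf P" "y \<in> set_pmf (W x)"
  shows "pmf (output_pmf P W) y > 0"
  using assms by (auto simp: output_pmf_def pmf_positive_iff)

text \<open>Splitting the logarithm leaves a term linear in \<open>P\<close> and an output entropy,
  a form whose continuity is visible even where output probabilities vanish.\<close>

lemma mutual_info_eq:
  "mutual_info P W =
     (\<Sum>x\<in>UNIV. \<Sum>y\<in>UNIV. pmf P x * pmf (W x) y * log 2 (pmf (W x) y)) -
     (\<Sum>y\<in>UNIV. pmf (output_pmf P W) y * log 2 (pmf (output_pmf P W) y))"
proof -
  have "pmf P x * pmf (W x) y * info_density P W x y =
      pmf P x * pmf (W x) y * log 2 (pmf (W x) y) -
      pmf P x * pmf (W x) y * log 2 (pmf (output_pmf P W) y)" for x y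
  proof (cases "x \<in> set_pmf P \<and> y \<in> set_pmf (W x)")
    case True
    then have "pmf (W x) y > 0" "pmf (output_pmf P W) y > 0"
      using pmf_output_pos[of x P y W] by (auto simp: pmf_positive)
    then show ?thesis
      by (simp add: info_density_def log_divide right_diff_distrib)
  qed (auto simp: set_pmf_iff)
  moreover have "(\<Sum>x\<in>UNIV. \<Sum>y\<in>UNIV. pmf P x * pmf (W x) y * log 2 (pmf (output_pmf P W) y)) =
      (\<Sum>y\<in>UNIV. pmf (output_pmf P W) y * log 2 (pmf (output_pmf P W) y))"
    by (subst sum.swap) (simp add: pmf_output sum_distrib_right)
  ultimately show ?thesis
    by (simp add: mutual_info_def sum_subtractf)
qed

lemma continuous_on_x_log_x: "continuous_on {0..} (\<lambda>x::real. x * log 2 x)"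
proof -
  have "continuous (at x within {0..}) (\<lambda>x::real. x * log 2 x)" if "x \<ge> 0" for x
  proof (cases "x = 0")
    case True
    have "((\<lambda>x::real. x * log 2 x) \<longlongrightarrow> 0) (at_right 0)"
      unfolding log_def by real_asymp
    then show ?thesis
      using True by (simp add: continuous_within at_within_Ici_at_right)
  next
    case False
    with that show ?thesis
      by (intro continuous_intros) auto
  qed
  then show ?thesis
    by (simp add: continuous_on_eq_continuous_within)
qed

text \<open>A continuous function on the compact probability simplex attains its maximum;
  \<open>vec_of\<close> and \<open>embed_pmf\<close> pass between distributions and points of the
  simplex.\<close>

lemma capacity_attained:
  fixes W :: "'x::finite \<Rightarrow> 'y::finite pmf"
  obtains P where "mutual_info P W = capacity W" "\<And>Q. mutual_info Q W \<le> capacity W"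
proof -
  define K where "K = {p :: real^'x. (\<forall>i. 0 \<le> p $ i) \<and> (\<Sum>i\<in>UNIV. p $ i) = 1}"
  define F where "F = (\<lambda>p :: real^'x.
     (\<Sum>x\<in>UNIV. \<Sum>y\<in>UNIV. p $ x * pmf (W x) y * log 2 (pmf (W x) y)) -
     (\<Sum>y\<in>UNIV. (\<Sum>x\<in>UNIV. p $ x * pmf (W x) y) * log 2 (\<Sum>x\<in>UNIV. p $ x * pmf (W x) y)))"
  define vec_of where "vec_of = (\<lambda>Q :: 'x pmf. \<chi> x. pmf Q x)"
  have F_eq: "F (vec_of Q) = mutual_info Q W" for Q
    by (simp add: F_def vec_of_def mutual_info_eq pmf_output)
  have vec_of_K: "vec_of Q \<in> K" for Q
    by (simp add: K_def vec_of_def sum_pmf_UNIV)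
  have "K \<subseteq> cbox 0 1"
  proof
    fix p assume p: "p \<in> K"
    have "p $ i \<le> 1" for i
      using member_le_sum[of i UNIV "\<lambda>i. p $ i"] p by (auto simp: K_def)
    with p show "p \<in> cbox 0 1"
      by (auto simp: mem_box_cart K_def)
  qed
  then have "bounded K"
    using bounded_cbox bounded_subset by blast
  moreover have "closed K"
    unfolding K_def by (intro closed_Collect_conj closed_Collect_all closed_Collect_le closed_Collect_eq continuous_intros)
  ultimately have "compact K"
    by (simp add: compact_eq_bounded_closed)
  have "continuous_on K (\<lambda>p. (\<Sum>x\<in>UNIV. p $ x * pmf (W x) y) * log 2 (\<Sum>x\<in>UNIV. p $ x * pmf (W x) y))" for y
    by (rule continuous_on_compose2[OF continuous_on_x_log_x])
      (auto simp: K_def intro!: sum_nonneg continuous_intros)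
  note entropy = this
  have "continuous_on K F"
    unfolding F_def by (rule continuous_on_diff; intro continuous_on_sum entropy) (intro continuous_intros)
  with \<open>compact K\<close> obtain p where p: "p \<in> K" and max: "\<And>q. q \<in> K \<Longrightarrow> F q \<le> F p"
    using continuous_attains_sup[of K F] vec_of_K by blast
  define P where "P = embed_pmf (\<lambda>x. p $ x)"
  have "pmf P x = p $ x" for x
    unfolding P_def using p
    by (intro pmf_embed_pmf)
      (auto simp: K_def nn_integral_count_space_finite sum_ennreal)
  then have "vec_of P = p"
    by (simp add: vec_of_def vec_eq_iff)
  then have *: "mutual_info Q W \<le> mutual_info P W" for Q
    using max[OF vec_of_K, of Q] F_eq by metis
  then have "capacity W = mutual_info P W"
    unfolding capacity_def by (intro cSup_eq_maximum) auto
  with * that show ?thesis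
    by metis
qed

section \<open>Optimality conditions and their effect on the variance\<close>

text \<open>Gibbs' inequality, termwise from \<open>ln z \<le> z - 1\<close>. The inclusion of
  supports excludes points where the convention \<open>a / 0 = 0\<close> would turn an infinite term
  into 0.\<close>

lemma relative_entropy_nonneg:
  fixes p q :: "'y::finite pmf"
  assumes "set_pmf p \<subseteq> set_pmf q"
  shows "(\<Sum>y\<in>UNIV. pmf p y * log 2 (pmf p y / pmf q y)) \<ge> 0"
proof -
  have "pmf p y * ln (pmf p y / pmf q y) \<ge> pmf p y - pmf q y" for y
  proof (cases "y \<in> set_pmf p")
    case True
    then have pos: "pmf p y > 0" "pmf q y > 0"
      using assms by (auto simp: pmf_positive)
    have "ln (pmf q y / pmf p y) \<le> pmf q y / pmf p y - 1"
      using pos by (intro ln_le_minus_one) simp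
    moreover have "ln (pmf p y / pmf q y) = - ln (pmf q y / pmf p y)"
      using pos by (simp add: ln_div)
    ultimately have "pmf p y * ln (pmf p y / pmf q y) \<ge> pmf p y * (1 - pmf q y / pmf p y)"
      using pos by (intro mult_left_mono) auto
    moreover have "pmf p y * (1 - pmf q y / pmf p y) = pmf p y - pmf q y"
      using pos by (simp add: right_diff_distrib)
    ultimately show ?thesis
      by simp
  qed (auto simp: set_pmf_iff)
  then have "(\<Sum>y\<in>UNIV. pmf p y * ln (pmf p y / pmf q y)) \<ge> (\<Sum>y\<in>UNIV. pmf p y - pmf q y)"
    by (intro sum_mono)
  then have "(\<Sum>y\<in>UNIV. pmf p y * ln (pmf p y / pmf q y)) / ln 2 \<ge> 0"
    by (simp add: sum_subtractf sum_pmf_UNIV)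
  then show ?thesis
    by (simp add: log_def sum_divide_distrib)
qed

text \<open>
  Moving mass \<open>\<lambda>\<close> from \<open>P\<close> to \<open>x\<close> cannot increase the mutual information. Comparing it with
  the relative entropies to the new output distribution gives
  \<open>C \<ge> (1 - \<lambda>) C + \<lambda> D(W x \<parallel> Q\<^sub>\<lambda>)\<close>; divide by \<open>\<lambda>\<close> and let \<open>\<lambda>\<close> tend to \<open>0\<close>.
\<close>
lemma capacity_achieving_divergence_le:
  fixes W :: "'x::finite \<Rightarrow> 'y::finite pmf"
  assumes P: "mutual_info P W = capacity W" and x: "x \<in> set_pmf P"
  shows "(\<Sum>y\<in>UNIV. pmf (W x) y * info_density P W x y) \<le> capacity W"
proof -
  have le: "mutual_info Q W \<le> capacity W" for Q
    by (rule capacity_attained[of W]) auto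
  let ?Q = "output_pmf P W"
  define q where "q = (\<lambda>l y. (1 - l) * pmf ?Q y + l * pmf (W x) y)"
  have pert: "(\<Sum>y\<in>UNIV. pmf (W x) y * log 2 (pmf (W x) y / q l y)) \<le> capacity W"
    if l: "0 < l" "l < 1" for l
  proof -
    define P' where "P' = bind_pmf (bernoulli_pmf l) (\<lambda>b. if b then return_pmf x else P)"
    let ?Q' = "output_pmf P' W"
    have P': "pmf P' z = (1 - l) * pmf P z + l * of_bool (z = x)" for z
      using l by (simp add: P'_def pmf_bind indicator_def)
    have at_x: "(\<Sum>z\<in>UNIV. l * (of_bool (z = x) * g z)) = l * g x" for g :: "'x \<Rightarrow> real"
      by (subst sum_distrib_left[symmetric]) simp
    have Q': "pmf ?Q' y = q l y" for y
      by (simp add: pmf_output P' q_def sum.distrib sum_distrib_left distrib_right mult.assoc at_x)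
    have supp: "set_pmf ?Q \<subseteq> set_pmf ?Q'"
      using l by (auto simp: set_pmf_iff Q' q_def add_nonneg_eq_0_iff)
    define D where "D = (\<lambda>z. \<Sum>y\<in>UNIV. pmf (W z) y * info_density P' W z y)"
    have "mutual_info P' W = (\<Sum>z\<in>UNIV. pmf P' z * D z)"
      by (simp add: mutual_info_def D_def sum_distrib_left mult.assoc)
    also have "\<dots> = (1 - l) * (\<Sum>z\<in>UNIV. pmf P z * D z) + l * D x"
      by (simp add: P' distrib_right sum.distrib sum_distrib_left mult.assoc at_x)
    finally have 1: "mutual_info P' W = (1 - l) * (\<Sum>z\<in>UNIV. pmf P z * D z) + l * D x" .
    \<comment> \<open>Replacing the old output distribution by the new one adds a term whose average
      is the relative entropy between the two, so the average of \<open>D\<close> under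
      \<open>P\<close> is at least the capacity.\<close>
    have "pmf P z * pmf (W z) y * info_density P' W z y = pmf P z * pmf (W z) y * info_density P W z y
        + pmf P z * pmf (W z) y * log 2 (pmf ?Q y / pmf ?Q' y)" for z y
    proof (cases "z \<in> set_pmf P \<and> y \<in> set_pmf (W z)")
      case True
      then have "pmf ?Q y > 0"
        by (intro pmf_output_pos) auto
      moreover from this have "pmf ?Q' y > 0"
        using supp by (auto simp: pmf_positive_iff)
      moreover have "pmf (W z) y > 0"
        using True by (auto simp: pmf_positive)
      ultimately show ?thesis
        by (simp add: info_density_def log_divide algebra_simps)
    qed (auto simp: set_pmf_iff)
    then have "(\<Sum>z\<in>UNIV. pmf P z * D z) = mutual_info P W +
       (\<Sum>z\<in>UNIV. \<Sum>y\<in>UNIV. pmf P z * pmf (W z) y * log 2 (pmf ?Q y / pmf ?Q' y))"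
      by (simp add: D_def mutual_info_def sum_distrib_left mult.assoc sum.distrib)
    also have "(\<Sum>z\<in>UNIV. \<Sum>y\<in>UNIV. pmf P z * pmf (W z) y * log 2 (pmf ?Q y / pmf ?Q' y)) =
       (\<Sum>y\<in>UNIV. pmf ?Q y * log 2 (pmf ?Q y / pmf ?Q' y))"
      by (subst sum.swap) (simp add: pmf_output sum_distrib_right)
    also have "mutual_info P W + \<dots> \<ge> capacity W"
      using relative_entropy_nonneg[OF supp] P by simp
    finally have "(1 - l) * (\<Sum>z\<in>UNIV. pmf P z * D z) \<ge> (1 - l) * capacity W"
      using l by (intro mult_left_mono) auto
    with 1 le[of P'] have "l * D x \<le> l * capacity W"
      by (simp add: algebra_simps)
    with l have "D x \<le> capacity W"
      by simp
    then show ?thesis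
      by (simp add: D_def info_density_def Q')
  qed
  \<comment> \<open>For \<open>y\<close> in the support of \<open>W x\<close> the limit of
    \<open>q l y\<close> is positive, since \<open>x\<close> lies in the support of
    \<open>P\<close>; every other term has weight 0.\<close>
  have "((\<lambda>l. \<Sum>y\<in>UNIV. pmf (W x) y * log 2 (pmf (W x) y / q l y)) \<longlongrightarrow>
      (\<Sum>y\<in>UNIV. pmf (W x) y * log 2 (pmf (W x) y / pmf ?Q y))) (at_right 0)"
  proof (intro tendsto_sum)
    fix y
    show "((\<lambda>l. pmf (W x) y * log 2 (pmf (W x) y / q l y)) \<longlongrightarrow>
       pmf (W x) y * log 2 (pmf (W x) y / pmf ?Q y)) (at_right 0)"
    proof (cases "y \<in> set_pmf (W x)")
      case True
      then have pos: "pmf ?Q y > 0" "pmf (W x) y > 0"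
        using x by (auto simp: pmf_output_pos pmf_positive)
      have "((\<lambda>l. q l y) \<longlongrightarrow> (1 - 0) * pmf ?Q y + 0 * pmf (W x) y) (at_right 0)"
        unfolding q_def by (intro tendsto_intros)
      then have "((\<lambda>l. q l y) \<longlongrightarrow> pmf ?Q y) (at_right 0)"
        by simp
      with pos show ?thesis
        by (intro tendsto_intros) auto
    qed (auto simp: set_pmf_iff)
  qed
  moreover have "eventually (\<lambda>l::real. 0 < l \<and> l < 1) (at_right 0)"
    by (auto intro: eventually_at_rightI[of 0 1])
  then have "eventually (\<lambda>l. (\<Sum>y\<in>UNIV. pmf (W x) y * log 2 (pmf (W x) y / q l y)) \<le> capacity W) (at_right 0)"
    by eventually_elim (use pert in auto)
  ultimately show ?thesis
    unfolding info_density_def by (rule tendsto_upperbound) auto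
qed

text \<open>The divergences average to the capacity under \<open>P\<close> and none exceeds it on
  the support, so every slack of positive weight vanishes.\<close>

lemma capacity_achieving_divergence_eq:
  fixes W :: "'x::finite \<Rightarrow> 'y::finite pmf"
  assumes P: "mutual_info P W = capacity W" and x: "x \<in> set_pmf P"
  shows "(\<Sum>y\<in>UNIV. pmf (W x) y * info_density P W x y) = capacity W"
proof -
  define D where "D = (\<lambda>z. \<Sum>y\<in>UNIV. pmf (W z) y * info_density P W z y)"
  have "(\<Sum>z\<in>UNIV. pmf P z * (capacity W - D z)) = capacity W - mutual_info P W"
    by (simp add: D_def mutual_info_def right_diff_distrib sum_subtractf sum_distrib_left mult.assoc
        flip: sum_distrib_right) (simp add: sum_pmf_UNIV)
  moreover have "pmf P z * (capacity W - D z) \<ge> 0" for z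
  proof (cases "z \<in> set_pmf P")
    case True
    then show ?thesis
      using capacity_achieving_divergence_le[OF P, of z] by (simp add: D_def)
  qed (auto simp: set_pmf_iff)
  ultimately have "pmf P x * (capacity W - D x) = 0"
    using P by (intro sum_nonneg_0[where s = UNIV and f = "\<lambda>z. pmf P z * (capacity W - D z)"]) simp_all
  with x have "D x = capacity W"
    by (simp add: set_pmf_iff)
  then show ?thesis
    by (simp add: D_def)
qed

text \<open>Given any \<open>x\<close> in the support, the information density has mean equal to the
  capacity, so centering at the capacity is centering at the conditional mean.\<close>

lemma capacity_achieving_second_moment:
  fixes W :: "'x::finite \<Rightarrow> 'y::finite pmf"
  assumes P: "mutual_info P W = capacity W"
  shows "(\<Sum>x\<in>UNIV. \<Sum>y\<in>UNIV. pmf P x * pmf (W x) y * (info_density P W x y - capacity W)\<^sup>2) =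
    cond_info_variance P W"
proof -
  have "cond_info_variance P W = (\<Sum>x\<in>UNIV. pmf P x * measure_pmf.variance (W x) (info_density P W x))"
    unfolding cond_info_variance_def by (subst integral_measure_pmf_real[of UNIV]) (auto simp: mult.commute)
  also have "\<dots> = (\<Sum>x\<in>UNIV. pmf P x * (\<Sum>y\<in>UNIV. pmf (W x) y * (info_density P W x y - capacity W)\<^sup>2))"
  proof (intro sum.cong refl)
    fix x
    show "pmf P x * measure_pmf.variance (W x) (info_density P W x) =
      pmf P x * (\<Sum>y\<in>UNIV. pmf (W x) y * (info_density P W x y - capacity W)\<^sup>2)"
    proof (cases "x \<in> set_pmf P")
      case True
      have "measure_pmf.expectation (W x) (info_density P W x) = capacity W"
        using capacity_achieving_divergence_eq[OF P True]
        by (subst integral_measure_pmf_real[of UNIV]) (auto simp: mult.commute)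
      then show ?thesis
        by (simp, subst integral_measure_pmf_real[of UNIV]) (auto simp: mult.commute)
    qed (auto simp: set_pmf_iff)
  qed
  finally show ?thesis
    by (simp add: sum_distrib_left mult.assoc)
qed

text \<open>At capacity 0 a constant input would be capacity-achieving with conditional variance 0,
  against the positive dispersion. Positivity lets \<open>n\<close> times the capacity outgrow the
  back-off \<open>n powr (1 - t)\<close>.\<close>

lemma capacity_pos:
  fixes W :: "'x::finite \<Rightarrow> 'y::finite pmf"
  assumes "dispersion W > 0"
  shows "capacity W > 0"
proof (rule ccontr)
  assume "\<not> capacity W > 0"
  define P :: "'x pmf" where "P = return_pmf undefined"
  have "output_pmf P W = W undefined"
    by (simp add: output_pmf_def P_def bind_return_pmf)
  \<comment> \<open>Either the weight is 0 or the density is \<open>log 2 1\<close>. A general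
    \<open>f\<close> serves both the mean and the second moment.\<close>
  then have zero: "pmf P x * pmf (W x) y * f (info_density P W x y) = 0" if "f 0 = 0"
    for x y and f :: "real \<Rightarrow> real"
    using that by (cases "pmf (W x) y = 0") (auto simp: info_density_def P_def indicator_def)
  have "mutual_info P W = 0"
    unfolding mutual_info_def by (intro sum.neutral ballI zero[of "\<lambda>i. i"]) auto
  moreover have "mutual_info P W \<le> capacity W"
    by (rule capacity_attained[of W]) auto
  ultimately have P: "mutual_info P W = capacity W" "capacity W = 0"
    using \<open>\<not> capacity W > 0\<close> by auto
  have "cond_info_variance P W = 0"
    unfolding capacity_achieving_second_moment[OF P(1), symmetric] P(2)
    by (intro sum.neutral ballI zero[of "\<lambda>i. (i - 0)\<^sup>2"]) auto
  moreover have "bdd_below ((\<lambda>P. cond_info_variance P W) ` {P. mutual_info P W = capacity W})"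
    by (rule bdd_belowI2[where m = 0]) (simp add: cond_info_variance_def)
  ultimately have "dispersion W \<le> 0"
    unfolding dispersion_def using P(1) by (intro cINF_lower2[where x = P]) auto
  with assms show False
    by simp
qed

text \<open>An infimum over a nonempty set is approached; the slack in the exponent absorbs the
  difference.\<close>

lemma exists_near_dispersion:
  fixes W :: "'x::finite \<Rightarrow> 'y::finite pmf"
  assumes "dispersion W < v"
  obtains P where "mutual_info P W = capacity W" "cond_info_variance P W < v"
proof -
  have "{P. mutual_info P W = capacity W} \<noteq> {}"
    by (rule capacity_attained[of W]) auto
  then have "\<exists>z\<in>(\<lambda>P. cond_info_variance P W) ` {P. mutual_info P W = capacity W}. z < v"
    using assms unfolding dispersion_def by (intro cInf_lessD) simp_all
  with that show ?thesis by blast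
qed

subsection \<open>Exponential moments of centered variables\<close>

text \<open>The coefficient is half of 21/20, which bounds the factor \<open>exp t\<close> of the
  Lagrange remainder.\<close>

lemma exp_le_quadratic:
  fixes u :: real
  assumes "\<bar>u\<bar> \<le> 1/25"
  shows "exp u \<le> 1 + u + 21/40 * u\<^sup>2"
proof -
  obtain t where t: "\<bar>t\<bar> \<le> \<bar>u\<bar>" "exp u = (\<Sum>m<2. (u ^ m) / fact m) + (exp t / fact 2) * u ^ 2"
    using Maclaurin_exp_le by blast
  have "exp t \<le> exp (1/25)"
    using t assms by simp
  also have "\<dots> \<le> 1 + 1/25 + (1/25)\<^sup>2"
    by (rule exp_bound) auto
  also have "\<dots> \<le> 21/20"
    by (simp add: power2_eq_square)
  finally have "exp t / 2 * u\<^sup>2 \<le> 21/40 * u\<^sup>2"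
    by (intro mult_right_mono) auto
  with t(2) show ?thesis
    by (simp add: eval_nat_numeral)
qed

text \<open>After the quadratic bound the linear term vanishes by centering, and
  \<open>1 + z \<le> exp z\<close> finishes. The sign of \<open>- s\<close> is that of a lower-tail
  bound.\<close>

lemma centered_mgf_bound:
  fixes w Z :: "'a \<Rightarrow> real"
  assumes "finite A" and w: "\<And>a. a \<in> A \<Longrightarrow> w a \<ge> 0" "sum w A = 1"
    and mean: "(\<Sum>a\<in>A. w a * Z a) = 0" and var: "(\<Sum>a\<in>A. w a * (Z a)\<^sup>2) \<le> v"
    and s: "\<And>a. a \<in> A \<Longrightarrow> \<bar>s * Z a\<bar> \<le> 1/25"
  shows "(\<Sum>a\<in>A. w a * exp (- s * Z a)) \<le> exp (21/40 * s\<^sup>2 * v)"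
proof -
  have "(\<Sum>a\<in>A. w a * exp (- s * Z a)) \<le> (\<Sum>a\<in>A. w a * (1 + (- s * Z a) + 21/40 * (- s * Z a)\<^sup>2))"
    using s w by (intro sum_mono mult_left_mono exp_le_quadratic) auto
  also have "\<dots> = sum w A - s * (\<Sum>a\<in>A. w a * Z a) + 21/40 * s\<^sup>2 * (\<Sum>a\<in>A. w a * (Z a)\<^sup>2)"
  proof -
    have "w a * (1 + (- s * Z a) + 21/40 * (- s * Z a)\<^sup>2) =
        w a - s * (w a * Z a) + 21/40 * s\<^sup>2 * (w a * (Z a)\<^sup>2)" for a
      by (simp add: power2_eq_square algebra_simps)
    then show ?thesis
      by (simp only: sum.distrib sum_subtractf flip: sum_distrib_left)
  qed
  also have "\<dots> \<le> 1 + 21/40 * s\<^sup>2 * v"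
    using w(2) mean var by (simp add: mult_left_mono)
  also have "\<dots> \<le> exp (21/40 * s\<^sup>2 * v)"
    by simp
  finally show ?thesis .
qed

subsection \<open>Expectations of products under finite product distributions\<close>

lemma nn_integral_swap_pmf:
  "(\<integral>\<^sup>+x. \<integral>\<^sup>+y. h x y \<partial>measure_pmf B \<partial>measure_pmf A) = (\<integral>\<^sup>+y. \<integral>\<^sup>+x. h x y \<partial>measure_pmf A \<partial>measure_pmf B)"
proof -
  have "(\<integral>\<^sup>+z. case_prod h z \<partial>bind_pmf A (\<lambda>x. bind_pmf B (\<lambda>y. return_pmf (x, y)))) =
      (\<integral>\<^sup>+z. case_prod h z \<partial>bind_pmf B (\<lambda>y. bind_pmf A (\<lambda>x. return_pmf (x, y))))"
    by (subst bind_commute_pmf) (rule refl)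
  then show ?thesis
    by simp
qed

lemma emeasure_le_nn_integral_pmf:
  assumes "\<And>z. z \<in> set_pmf p \<Longrightarrow> z \<in> E \<Longrightarrow> 1 \<le> f z"
  shows "emeasure (measure_pmf p) E \<le> (\<integral>\<^sup>+z. f z \<partial>measure_pmf p)"
proof -
  have "emeasure (measure_pmf p) E = (\<integral>\<^sup>+z. indicator E z \<partial>measure_pmf p)"
    by simp
  also have "\<dots> \<le> (\<integral>\<^sup>+z. f z \<partial>measure_pmf p)"
    using assms by (intro nn_integral_mono_AE AE_pmfI) (auto split: split_indicator)
  finally show ?thesis .
qed

lemma nn_integral_finite_pmf:
  fixes p :: "'a::finite pmf"
  assumes "\<And>x. f x \<ge> 0"
  shows "(\<integral>\<^sup>+x. ennreal (f x) \<partial>measure_pmf p) = ennreal (\<Sum>x\<in>UNIV. pmf p x * f x)"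
  using assms by (simp add: nn_integral_measure_pmf nn_integral_count_space_finite sum_ennreal flip: ennreal_mult)

lemma nn_integral_prod_Pi_pmf_subset:
  assumes "finite A" "B \<subseteq> A"
  shows "(\<integral>\<^sup>+y. (\<Prod>x\<in>B. f x (y x)) \<partial>Pi_pmf A dflt p) = (\<Prod>x\<in>B. \<integral>\<^sup>+y. f x y \<partial>measure_pmf (p x))"
proof -
  define f' where "f' = (\<lambda>x y. if x \<in> B then f x y else 1)"
  have "(\<Prod>x\<in>B. f x (y x)) = (\<Prod>x\<in>A. f' x (y x))" for y
    using assms by (intro prod.mono_neutral_cong_left) (auto simp: f'_def)
  then have "(\<integral>\<^sup>+y. (\<Prod>x\<in>B. f x (y x)) \<partial>Pi_pmf A dflt p) = (\<Prod>x\<in>A. \<integral>\<^sup>+y. f' x y \<partial>measure_pmf (p x))"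
    using nn_integral_prod_Pi_pmf[OF assms(1), of dflt p f'] by simp
  also have "\<dots> = (\<Prod>x\<in>B. \<integral>\<^sup>+y. f x y \<partial>measure_pmf (p x))"
    using assms by (intro prod.mono_neutral_cong_right) (auto simp: f'_def)
  finally show ?thesis .
qed

text \<open>Injectivity of \<open>a\<close> makes the selected coordinates distinct, hence
  independent.\<close>

lemma nn_integral_prod_Pi_pmf_inj:
  assumes "finite A" "inj_on a D" "a ` D \<subseteq> A"
  shows "(\<integral>\<^sup>+C. (\<Prod>d\<in>D. f d (C (a d))) \<partial>Pi_pmf A dflt p) = (\<Prod>d\<in>D. \<integral>\<^sup>+x. f d x \<partial>measure_pmf (p (a d)))"
proof -
  have "(\<Prod>d\<in>D. f d (C (a d))) = (\<Prod>z\<in>a ` D. f (inv_into D a z) (C z))" for C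
    using assms(2) by (subst prod.reindex) auto
  then have "(\<integral>\<^sup>+C. (\<Prod>d\<in>D. f d (C (a d))) \<partial>Pi_pmf A dflt p) =
      (\<Prod>z\<in>a ` D. \<integral>\<^sup>+x. f (inv_into D a z) x \<partial>measure_pmf (p z))"
    by (simp add: nn_integral_prod_Pi_pmf_subset[OF assms(1,3), where f = "\<lambda>z. f (inv_into D a z)"])
  also have "\<dots> = (\<Prod>d\<in>D. \<integral>\<^sup>+x. f d x \<partial>measure_pmf (p (a d)))"
    using assms(2) by (subst prod.reindex) auto
  finally show ?thesis .
qed

lemma nn_integral_prod_pairs_Pi_pmf_le_1:
  assumes "finite A" "inj_on b D" "b ` D \<subseteq> A" "a ` D \<subseteq> A" "a ` D \<inter> b ` D = {}"
    and F: "\<And>d x. d \<in> D \<Longrightarrow> (\<integral>\<^sup>+z. F d x z \<partial>measure_pmf (p (b d))) \<le> 1"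
  shows "(\<integral>\<^sup>+C. (\<Prod>d\<in>D. F d (C (a d)) (C (b d))) \<partial>Pi_pmf A dflt p) \<le> 1"
proof -
  define B where "B = A - b ` D"
  have fin: "finite B" "finite (b ` D)"
    using assms by (auto simp: B_def dest: finite_subset)
  have A: "A = B \<union> b ` D"
    using assms by (auto simp: B_def)
  have sel: "a d \<in> B" "b d \<notin> B" if "d \<in> D" for d
    using that assms by (auto simp: B_def)
  have "(\<integral>\<^sup>+C. (\<Prod>d\<in>D. F d (C (a d)) (C (b d))) \<partial>Pi_pmf A dflt p) =
      (\<integral>\<^sup>+f. \<integral>\<^sup>+g. (\<Prod>d\<in>D. F d (f (a d)) (g (b d))) \<partial>Pi_pmf (b ` D) dflt p \<partial>Pi_pmf B dflt p)"
    unfolding A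
    by (subst Pi_pmf_union) (use fin sel in \<open>auto simp: B_def nn_integral_pair_pmf' case_prod_unfold intro!: nn_integral_cong prod.cong\<close>)
  also have "\<dots> \<le> (\<integral>\<^sup>+f. 1 \<partial>Pi_pmf B dflt p)"
  proof (intro nn_integral_mono)
    fix f
    have "(\<integral>\<^sup>+g. (\<Prod>d\<in>D. F d (f (a d)) (g (b d))) \<partial>Pi_pmf (b ` D) dflt p) =
        (\<Prod>d\<in>D. \<integral>\<^sup>+z. F d (f (a d)) z \<partial>measure_pmf (p (b d)))"
      using fin assms(2) by (intro nn_integral_prod_Pi_pmf_inj[where f = "\<lambda>d. F d (f (a d))"]) auto
    also have "\<dots> \<le> 1"
      using F by (intro prod_le_1) auto
    finally show "(\<integral>\<^sup>+g. (\<Prod>d\<in>D. F d (f (a d)) (g (b d))) \<partial>Pi_pmf (b ` D) dflt p) \<le> 1" .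
  qed
  also have "\<dots> = 1"
    by simp
  finally show ?thesis .
qed

text \<open>This is \<open>2 powr info_density\<close> at pairs of positive probability. At
  impossible outputs it is 0, whereas the convention \<open>log 2 0 = 0\<close> would give
  1.\<close>

definition likelihood_ratio :: "'x pmf \<Rightarrow> ('x::finite \<Rightarrow> 'y::finite pmf) \<Rightarrow> 'x \<Rightarrow> 'y \<Rightarrow> real" where
  "likelihood_ratio P W x y = pmf (W x) y / pmf (output_pmf P W) y"

lemma likelihood_ratio_nonneg: "likelihood_ratio P W x y \<ge> 0"
  by (simp add: likelihood_ratio_def)

lemma likelihood_ratio_pos:
  "x \<in> set_pmf P \<Longrightarrow> y \<in> set_pmf (W x) \<Longrightarrow> likelihood_ratio P W x y > 0"
  by (auto simp: likelihood_ratio_def pmf_positive pmf_output_pos)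

text \<open>
  An inequality and not an equality, because the ratio is \<open>0\<close> at outputs of probability zero
  under the output distribution.
\<close>
lemma nn_integral_likelihood_ratio_le_1:
  "(\<integral>\<^sup>+x. ennreal (likelihood_ratio P W x y) \<partial>measure_pmf P) \<le> 1"
proof -
  have "(\<Sum>x\<in>UNIV. pmf P x * likelihood_ratio P W x y) =
      (\<Sum>x\<in>UNIV. pmf P x * pmf (W x) y) / pmf (output_pmf P W) y"
    by (simp add: likelihood_ratio_def sum_divide_distrib)
  also have "\<dots> \<le> 1"
    by (simp add: divide_simps flip: pmf_output)
  finally show ?thesis
    by (subst nn_integral_finite_pmf) (auto simp: likelihood_ratio_nonneg)
qed

lemma sum_power_tail_le:
  fixes c :: real
  assumes "0 \<le> c" "c \<le> 1/2"
  shows "(\<Sum>j=1..k. c ^ (k + T - j)) \<le> 2 * c ^ T"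
proof -
  have "(\<Sum>i<k. c ^ i) \<le> (\<Sum>i<k. (1/2) ^ i)"
    using assms by (intro sum_mono power_mono) auto
  also have "\<dots> \<le> 2"
    by (simp add: sum_gp_strict)
  finally have "(\<Sum>i<k. c ^ i) * c ^ T \<le> 2 * c ^ T"
    using assms(1) by (intro mult_right_mono) auto
  moreover have "(\<Sum>j=1..k. c ^ (k + T - j)) = (\<Sum>i<k. c ^ i * c ^ T)"
    by (rule sum.reindex_bij_witness[of _ "\<lambda>i. k - i" "\<lambda>j. k - j"]) (auto simp: add.commute simp flip: power_add)
  ultimately show ?thesis
    by (simp add: sum_distrib_right)
qed

subsection \<open>Random coding\<close>

text \<open>\<open>\<rho>\<close> is the threshold per symbol and \<open>s\<close> the Chernoff
  parameter. \<open>count_le\<close> makes the union bound over wrong messages cost at most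
  \<open>c\<close> per block; \<open>mgf_le\<close> bounds by \<open>c\<close> the block factor for
  the true codeword falling below the threshold.\<close>

locale random_streaming_code =
  fixes W :: "'x::finite \<Rightarrow> 'y::finite pmf" and P :: "'x pmf" and n M T S :: nat and \<rho> s c :: real
  assumes n_pos: "n > 0" and M_pos: "M > 0" and T_pos: "T > 0" and S_pos: "S > 0"
    and rho_pos: "\<rho> > 0" and s_nonneg: "s \<ge> 0" and c_pos: "c > 0" and c_le: "c \<le> 1/2"
    and count_le: "real M \<le> c * \<rho> ^ n"
    and mgf_le: "(\<Sum>x\<in>UNIV. \<Sum>y\<in>UNIV. pmf P x * pmf (W x) y *
                   (\<rho> / likelihood_ratio P W x y) powr s) ^ n \<le> c"
begin

text \<open>
  The symbol that a codebook uses at time \<open>i\<close> of block \<open>l\<close> is indexed by \<open>(l, g, i)\<close>, where \<open>g\<close> is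
  the message prefix known to the encoder in block \<open>l\<close>. All these symbols are drawn independently.
\<close>
definition positions :: "(nat \<times> (nat \<Rightarrow> nat) \<times> nat) set" where
  "positions = (SIGMA l:{1..S + T - 1}. ({1..min l S} \<rightarrow>\<^sub>E {1..M}) \<times> {1..n})"

definition pos :: "(nat \<Rightarrow> nat) \<Rightarrow> nat \<times> nat \<Rightarrow> nat \<times> (nat \<Rightarrow> nat) \<times> nat" where
  "pos g = (\<lambda>(l, i). (l, restrict g {1..min l S}, i))"

definition codebook :: "(nat \<times> (nat \<Rightarrow> nat) \<times> nat \<Rightarrow> 'x) pmf" where
  "codebook = Pi_pmf positions undefined (\<lambda>_. P)"

definition outputs :: "(nat \<times> (nat \<Rightarrow> nat) \<times> nat \<Rightarrow> 'x) \<Rightarrow> (nat \<Rightarrow> nat) \<Rightarrow> (nat \<Rightarrow> nat \<Rightarrow> 'y) pmf" where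
  "outputs C G = Pi_pmf {1..S + T - 1} undefined (\<lambda>l. block_channel W n (\<lambda>i. C (pos G (l, i))))"

definition joint :: "(nat \<Rightarrow> nat) \<Rightarrow> ((nat \<times> (nat \<Rightarrow> nat) \<times> nat \<Rightarrow> 'x) \<times> (nat \<Rightarrow> nat \<Rightarrow> 'y)) pmf" where
  "joint G = bind_pmf codebook (\<lambda>C. map_pmf (Pair C) (outputs C G))"

definition score :: "(nat \<times> (nat \<Rightarrow> nat) \<times> nat \<Rightarrow> 'x) \<Rightarrow> (nat \<Rightarrow> nat \<Rightarrow> 'y) \<Rightarrow> nat \<Rightarrow> nat \<Rightarrow> (nat \<Rightarrow> nat) \<Rightarrow> real" where
  "score C Y j K g = (\<Prod>(l, i)\<in>{j..K} \<times> {1..n}. likelihood_ratio P W (C (pos g (l, i))) (Y l i))"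

text \<open>Messages after \<open>k\<close> that enter the received blocks are guessed along. The
  exponent \<open>k + T - j\<close> counts the blocks from \<open>j\<close> to
  \<open>k + T - 1\<close>.\<close>

definition candidates :: "(nat \<times> (nat \<Rightarrow> nat) \<times> nat \<Rightarrow> 'x) \<Rightarrow> (nat \<Rightarrow> nat \<Rightarrow> 'y) \<Rightarrow> nat \<Rightarrow> (nat \<Rightarrow> nat) set" where
  "candidates C Y k = {g \<in> {1..min (k + T - 1) S} \<rightarrow>\<^sub>E {1..M}.
      \<forall>j\<in>{1..k}. score C Y j (k + T - 1) g > (\<rho> ^ n) ^ (k + T - j)}"

definition decode :: "(nat \<times> (nat \<Rightarrow> nat) \<times> nat \<Rightarrow> 'x) \<Rightarrow> nat \<Rightarrow> (nat \<Rightarrow> nat \<Rightarrow> 'y) \<Rightarrow> nat" where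
  "decode C k Y = (if candidates C Y k = {} then 1 else (SOME g. g \<in> candidates C Y k) k)"

section \<open>Error events of the random code\<close>

lemma finite_positions: "finite positions"
  unfolding positions_def by (intro finite_SigmaI finite_cartesian_product finite_PiE) auto

lemma inj_on_pos: "inj_on (pos g) D"
  by (auto simp: pos_def inj_on_def)

lemma pos_in_positions:
  assumes "\<And>i. i \<in> {1..min l S} \<Longrightarrow> g i \<in> {1..M}" "l \<in> {1..S + T - 1}" "i \<in> {1..n}"
  shows "pos g (l, i) \<in> positions"
  using assms by (auto simp: pos_def positions_def)

lemma set_codebook: "C \<in> set_pmf codebook \<Longrightarrow> z \<in> positions \<Longrightarrow> C z \<in> set_pmf P"
  by (cases z) (auto simp: codebook_def set_Pi_pmf[OF finite_positions] PiE_dflt_def)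

lemma set_outputs:
  assumes "Y \<in> set_pmf (outputs C G)" "l \<in> {1..S + T - 1}" "i \<in> {1..n}"
  shows "Y l i \<in> set_pmf (W (C (pos G (l, i))))"
proof -
  have "Y l \<in> set_pmf (block_channel W n (\<lambda>i. C (pos G (l, i))))"
    using assms(1,2) by (auto simp: outputs_def set_Pi_pmf PiE_dflt_def)
  with assms(3) show ?thesis
    by (auto simp: block_channel_def set_Pi_pmf PiE_dflt_def)
qed

text \<open>Given the codebook the channel is memoryless, so the product leaves the integral first
  over blocks and then over symbols.\<close>

lemma nn_integral_joint_prod:
  assumes "1 \<le> j" "K \<le> S + T - 1"
  shows "(\<integral>\<^sup>+(C, Y). (\<Prod>d\<in>{j..K} \<times> {1..n}. f d C (Y (fst d) (snd d))) \<partial>joint G) =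
    (\<integral>\<^sup>+C. (\<Prod>d\<in>{j..K} \<times> {1..n}. \<integral>\<^sup>+y. f d C y \<partial>W (C (pos G d))) \<partial>codebook)"
proof -
  have "(\<integral>\<^sup>+Y. (\<Prod>d\<in>{j..K} \<times> {1..n}. f d C (Y (fst d) (snd d))) \<partial>outputs C G) =
     (\<Prod>d\<in>{j..K} \<times> {1..n}. \<integral>\<^sup>+y. f d C y \<partial>W (C (pos G d)))" for C
  proof -
    have "(\<integral>\<^sup>+Y. (\<Prod>d\<in>{j..K} \<times> {1..n}. f d C (Y (fst d) (snd d))) \<partial>outputs C G) =
      (\<integral>\<^sup>+Y. (\<Prod>l\<in>{j..K}. (\<lambda>y. \<Prod>i\<in>{1..n}. f (l, i) C (y i)) (Y l)) \<partial>outputs C G)"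
      by (simp add: prod.cartesian_product case_prod_unfold)
    also have "\<dots> = (\<Prod>l\<in>{j..K}. \<integral>\<^sup>+y. (\<Prod>i\<in>{1..n}. f (l, i) C (y i)) \<partial>block_channel W n (\<lambda>i. C (pos G (l, i))))"
      unfolding outputs_def using assms by (intro nn_integral_prod_Pi_pmf_subset) auto
    also have "\<dots> = (\<Prod>l\<in>{j..K}. \<Prod>i\<in>{1..n}. \<integral>\<^sup>+y. f (l, i) C y \<partial>W (C (pos G (l, i))))"
      unfolding block_channel_def by (intro prod.cong refl nn_integral_prod_Pi_pmf) auto
    finally show ?thesis
      by (simp add: prod.cartesian_product case_prod_unfold)
  qed
  then show ?thesis
    by (simp add: joint_def)
qed

text \<open>Chernoff bound: on the event, threshold over score raised to the power \<open>s\<close>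
  is at least 1. Its expectation factorizes because one message sequence never uses a codebook
  position twice.\<close>

lemma prob_true_score_le:
  assumes G: "\<And>i. i \<in> {1..S} \<Longrightarrow> G i \<in> {1..M}" and jK: "1 \<le> j" "j \<le> K" "K \<le> S + T - 1"
  shows "emeasure (joint G) {(C, Y). score C Y j K G \<le> (\<rho> ^ n) ^ (Suc K - j)} \<le> ennreal (c ^ (Suc K - j))"
proof -
  let ?D = "{j..K} \<times> {1..n}"
  define h where "h = (\<lambda>x y. (\<rho> / likelihood_ratio P W x y) powr s)"
  define m where "m = (\<Sum>x\<in>UNIV. \<Sum>y\<in>UNIV. pmf P x * pmf (W x) y * h x y)"
  have h_nonneg: "h x y \<ge> 0" for x y
    by (simp add: h_def)
  have m_nonneg: "m \<ge> 0"
    by (auto simp: m_def h_nonneg intro!: sum_nonneg mult_nonneg_nonneg)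
  have card: "card ?D = n * (Suc K - j)"
    by simp
  have pos: "pos G d \<in> positions" if "d \<in> ?D" for d
    using that jK G by (cases d) (auto intro!: pos_in_positions)
  have "emeasure (joint G) {(C, Y). score C Y j K G \<le> (\<rho> ^ n) ^ (Suc K - j)} \<le>
      (\<integral>\<^sup>+(C, Y). (\<Prod>d\<in>?D. ennreal (h (C (pos G d)) (Y (fst d) (snd d)))) \<partial>joint G)"
  proof (rule emeasure_le_nn_integral_pmf)
    fix z assume z: "z \<in> set_pmf (joint G)" "z \<in> {(C, Y). score C Y j K G \<le> (\<rho> ^ n) ^ (Suc K - j)}"
    obtain C Y where CY: "z = (C, Y)" "C \<in> set_pmf codebook" "Y \<in> set_pmf (outputs C G)"
      using z(1) by (auto simp: joint_def)
    have score: "score C Y j K G \<le> (\<rho> ^ n) ^ (Suc K - j)"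
      using z(2) CY by simp
    let ?r = "\<lambda>d. likelihood_ratio P W (C (pos G d)) (Y (fst d) (snd d))"
    \<comment> \<open>On the support of \<open>joint G\<close> no ratio vanishes, so dividing by the
      score is legitimate.\<close>
    have r_pos: "?r d > 0" if "d \<in> ?D" for d
    proof -
      have "Y (fst d) (snd d) \<in> set_pmf (W (C (pos G d)))"
        using that jK set_outputs[OF CY(3), of "fst d" "snd d"] by (auto simp: mem_Times_iff)
      with pos[OF that] CY(2) show ?thesis
        by (intro likelihood_ratio_pos set_codebook)
    qed
    have score_eq: "score C Y j K G = (\<Prod>d\<in>?D. ?r d)"
      by (simp add: score_def case_prod_unfold)
    have "(\<Prod>d\<in>?D. \<rho>) = (\<rho> ^ n) ^ (Suc K - j)"
      by (simp only: prod_constant card power_mult)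
    then have "(\<Prod>d\<in>?D. \<rho> / ?r d) = (\<rho> ^ n) ^ (Suc K - j) / (\<Prod>d\<in>?D. ?r d)"
      by (simp only: prod_dividef)
    also have "\<dots> \<ge> 1"
      using score r_pos by (subst le_divide_eq_1_pos) (auto simp: score_eq intro!: prod_pos)
    finally have "1 \<le> (\<Prod>d\<in>?D. \<rho> / ?r d) powr s"
      using s_nonneg by (simp add: ge_one_powr_ge_zero)
    also have "\<dots> = (\<Prod>d\<in>?D. h (C (pos G d)) (Y (fst d) (snd d)))"
      unfolding h_def by (rule prod_powr_distrib)
    finally show "1 \<le> (case z of (C, Y) \<Rightarrow> \<Prod>d\<in>?D. ennreal (h (C (pos G d)) (Y (fst d) (snd d))))"
      by (simp add: CY(1) prod_ennreal h_nonneg)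
  qed
  also have "\<dots> = (\<integral>\<^sup>+C. (\<Prod>d\<in>?D. (\<lambda>x. \<integral>\<^sup>+y. ennreal (h x y) \<partial>W x) (C (pos G d))) \<partial>codebook)"
    using jK by (intro nn_integral_joint_prod) auto
  also have "\<dots> = (\<Prod>d\<in>?D. \<integral>\<^sup>+x. \<integral>\<^sup>+y. ennreal (h x y) \<partial>W x \<partial>P)"
    unfolding codebook_def using pos
    by (intro nn_integral_prod_Pi_pmf_inj finite_positions inj_on_pos) auto
  also have "(\<integral>\<^sup>+x. \<integral>\<^sup>+y. ennreal (h x y) \<partial>W x \<partial>P) = ennreal m"
    by (simp add: nn_integral_finite_pmf h_nonneg sum_nonneg m_def sum_distrib_left mult.assoc)
  also have "(\<Prod>d\<in>?D. ennreal m) = ennreal ((m ^ n) ^ (Suc K - j))"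
    by (simp only: prod_constant card power_mult[symmetric] ennreal_power[OF m_nonneg])
  also have "\<dots> \<le> ennreal (c ^ (Suc K - j))"
    using mgf_le m_nonneg by (intro ennreal_leI power_mono) (auto simp: m_def h_def)
  finally show ?thesis .
qed

text \<open>From block \<open>j\<close> on the codewords of \<open>g\<close> are independent of the
  outputs, so the score has mean at most 1, and Markov's inequality applies.\<close>

lemma prob_wrong_score_gt:
  assumes G: "\<And>i. i \<in> {1..S} \<Longrightarrow> G i \<in> {1..M}" and jK: "1 \<le> j" "j \<le> K" "K \<le> S + T - 1" "j \<le> S"
    and g: "\<And>i. i \<in> {1..min K S} \<Longrightarrow> g i \<in> {1..M}" and neq: "g j \<noteq> G j"
  shows "emeasure (joint G) {(C, Y). score C Y j K g > (\<rho> ^ n) ^ (Suc K - j)} \<le> ennreal (1 / (\<rho> ^ n) ^ (Suc K - j))"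
proof -
  let ?D = "{j..K} \<times> {1..n}"
  let ?r = "\<lambda>g C Y d. likelihood_ratio P W (C (pos g d)) (Y (fst d) (snd d))"
  define \<Gamma> where "\<Gamma> = (\<rho> ^ n) ^ (Suc K - j)"
  have \<Gamma>: "\<Gamma> > 0"
    using rho_pos by (simp add: \<Gamma>_def)
  have posG: "pos G d \<in> positions" if "d \<in> ?D" for d
    using that jK G by (cases d) (auto intro!: pos_in_positions)
  have posg: "pos g d \<in> positions" if "d \<in> ?D" for d
    using that jK g by (cases d) (auto intro!: pos_in_positions)
  have disj: "pos G ` ?D \<inter> pos g ` ?D = {}"
  proof -
    \<comment> \<open>The prefixes differ at coordinate \<open>j\<close>, which they contain because
      \<open>j \<le> l\<close> and \<open>j \<le> S\<close>.\<close>
    have "restrict G {1..min l S} \<noteq> restrict g {1..min l S}" if "l \<in> {j..K}" for l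
    proof
      assume "restrict G {1..min l S} = restrict g {1..min l S}"
      then have "restrict G {1..min l S} j = restrict g {1..min l S} j"
        by simp
      with that jK neq show False
        by (auto split: if_splits)
    qed
    then show ?thesis
      by (auto simp: pos_def)
  qed
  have "emeasure (joint G) {(C, Y). score C Y j K g > \<Gamma>} \<le>
      (\<integral>\<^sup>+z. ennreal (1 / \<Gamma>) * (case z of (C, Y) \<Rightarrow> \<Prod>d\<in>?D. ennreal (?r g C Y d)) \<partial>joint G)"
  proof (rule emeasure_le_nn_integral_pmf)
    fix z assume "z \<in> {(C, Y). score C Y j K g > \<Gamma>}"
    then obtain C Y where CY: "z = (C, Y)" "score C Y j K g > \<Gamma>"
      by auto
    then have "1 \<le> 1 / \<Gamma> * (\<Prod>d\<in>?D. ?r g C Y d)"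
      using \<Gamma> by (simp add: score_def case_prod_unfold)
    then show "1 \<le> ennreal (1 / \<Gamma>) * (case z of (C, Y) \<Rightarrow> \<Prod>d\<in>?D. ennreal (?r g C Y d))"
      using \<Gamma> by (simp add: CY(1) prod_ennreal likelihood_ratio_nonneg prod_nonneg flip: ennreal_mult)
  qed
  also have "\<dots> = ennreal (1 / \<Gamma>) * (\<integral>\<^sup>+(C, Y). (\<Prod>d\<in>?D. ennreal (?r g C Y d)) \<partial>joint G)"
    by (simp add: nn_integral_cmult)
  also have "(\<integral>\<^sup>+(C, Y). (\<Prod>d\<in>?D. ennreal (?r g C Y d)) \<partial>joint G) =
      (\<integral>\<^sup>+C. (\<Prod>d\<in>?D. \<integral>\<^sup>+y. ennreal (likelihood_ratio P W (C (pos g d)) y) \<partial>W (C (pos G d))) \<partial>codebook)"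
    using jK by (intro nn_integral_joint_prod) auto
  also have "\<dots> \<le> 1"
    unfolding codebook_def
  proof (rule nn_integral_prod_pairs_Pi_pmf_le_1[where
      F = "\<lambda>_ x z. \<integral>\<^sup>+y. ennreal (likelihood_ratio P W z y) \<partial>W x"])
    fix x
    have "(\<integral>\<^sup>+z. \<integral>\<^sup>+y. ennreal (likelihood_ratio P W z y) \<partial>W x \<partial>P) =
        (\<integral>\<^sup>+y. \<integral>\<^sup>+z. ennreal (likelihood_ratio P W z y) \<partial>P \<partial>W x)"
      by (rule nn_integral_swap_pmf)
    also have "\<dots> \<le> (\<integral>\<^sup>+y. 1 \<partial>W x)"
      by (intro nn_integral_mono nn_integral_likelihood_ratio_le_1)
    finally show "(\<integral>\<^sup>+z. \<integral>\<^sup>+y. ennreal (likelihood_ratio P W z y) \<partial>W x \<partial>P) \<le> 1"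
      by simp
  qed (use posG posg disj finite_positions inj_on_pos in auto)
  finally show ?thesis
    unfolding \<Gamma>_def by (simp add: mult_left_mono)
qed

text \<open>Only the entries from \<open>j\<close> to \<open>min K S\<close> are free. The bound
  uses the number of blocks instead, to match the exponent of the threshold.\<close>

lemma card_common_prefix_le:
  assumes "1 \<le> j" "j \<le> K"
  shows "card {g \<in> {1..min K S} \<rightarrow>\<^sub>E {1..M}. \<forall>i\<in>{1..<j}. g i = G i} \<le> M ^ (Suc K - j)"
proof -
  let ?A = "{g \<in> {1..min K S} \<rightarrow>\<^sub>E {1..M}. \<forall>i\<in>{1..<j}. g i = G i}"
  have "inj_on (\<lambda>g. restrict g {j..min K S}) ?A"
  proof (rule inj_onI)
    fix g g' assume gg: "g \<in> ?A" "g' \<in> ?A" "restrict g {j..min K S} = restrict g' {j..min K S}"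
    show "g = g'"
    proof (rule PiE_ext[of g "{1..min K S}" "\<lambda>_. {1..M}"])
      fix i assume "i \<in> {1..min K S}"
      then show "g i = g' i"
        using gg(1,2) fun_cong[OF gg(3), of i] by (cases "i < j") (auto split: if_splits)
    qed (use gg in auto)
  qed
  moreover have "(\<lambda>g. restrict g {j..min K S}) ` ?A \<subseteq> {j..min K S} \<rightarrow>\<^sub>E {1..M}"
    using assms by (auto simp: PiE_def Pi_def)
  ultimately have "card ?A \<le> card ({j..min K S} \<rightarrow>\<^sub>E {1..M})"
    by (intro card_inj_on_le) (auto intro!: finite_PiE)
  also have "\<dots> = M ^ (Suc (min K S) - j)"
    by (simp add: card_PiE)
  also have "\<dots> \<le> M ^ (Suc K - j)"
    using M_pos by (intro power_increasing) auto
  finally show ?thesis .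
qed

lemma prob_decoding_error_le:
  assumes G: "\<And>i. i \<in> {1..S} \<Longrightarrow> G i \<in> {1..M}" and k: "k \<in> {1..S}"
  shows "emeasure (joint G) {(C, Y). decode C k Y \<noteq> G k} \<le> ennreal (4 * c ^ T)"
proof -
  define K where "K = k + T - 1"
  have K: "k \<le> K" "K \<le> S + T - 1" "\<And>j. k + T - j = Suc K - j"
    using k T_pos by (auto simp: K_def)
  define A where "A = (\<lambda>j. {(C, Y). score C Y j K G \<le> (\<rho> ^ n) ^ (Suc K - j)})"
  define B where "B = (\<lambda>j g. {(C, Y). score C Y j K g > (\<rho> ^ n) ^ (Suc K - j)})"
  define wrong where "wrong = (\<lambda>j. {g \<in> {1..min K S} \<rightarrow>\<^sub>E {1..M}. (\<forall>i\<in>{1..<j}. g i = G i) \<and> g j \<noteq> G j})"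
  have finite_wrong: "finite (wrong j)" for j
    by (rule finite_subset[of _ "{1..min K S} \<rightarrow>\<^sub>E {1..M}"]) (auto simp: wrong_def intro!: finite_PiE)
  have "{(C, Y). decode C k Y \<noteq> G k} \<subseteq> (\<Union>j\<in>{1..k}. A j \<union> (\<Union>g\<in>wrong j. B j g))"
  proof (clarify, rule ccontr)
    fix C Y assume err: "decode C k Y \<noteq> G k" and "(C, Y) \<notin> (\<Union>j\<in>{1..k}. A j \<union> (\<Union>g\<in>wrong j. B j g))"
    then have notA: "\<And>j. j \<in> {1..k} \<Longrightarrow> score C Y j K G > (\<rho> ^ n) ^ (Suc K - j)"
      and notB: "\<And>j g. j \<in> {1..k} \<Longrightarrow> g \<in> wrong j \<Longrightarrow> score C Y j K g \<le> (\<rho> ^ n) ^ (Suc K - j)"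
      by (auto simp: A_def B_def not_le not_less)
    \<comment> \<open>The true sequence, cut to the messages that enter the received blocks, is a
      candidate outside the events \<open>A j\<close>; scores up to block \<open>K\<close> ignore
      the rest.\<close>
    define G' where "G' = restrict G {1..min K S}"
    have "score C Y j K G' = score C Y j K G" for j
      unfolding score_def by (intro prod.cong refl) (auto simp: pos_def G'_def Int_absorb1)
    moreover have "G' \<in> {1..min K S} \<rightarrow>\<^sub>E {1..M}"
      using G by (auto simp: G'_def)
    ultimately have "G' \<in> candidates C Y k"
      unfolding candidates_def K_def[symmetric] K(3) using notA by simp
    then have ne: "candidates C Y k \<noteq> {}"
      by auto
    define g where "g = (SOME g. g \<in> candidates C Y k)"
    have g: "g \<in> candidates C Y k"
      unfolding g_def using ne by (simp add: some_in_eq)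
    have "g k \<noteq> G k"
      using err ne by (simp add: decode_def g_def)
    \<comment> \<open>The first disagreement is at most \<open>k\<close>, so \<open>g\<close> lies
      in \<open>wrong j\<close> and, as a candidate, passes the threshold at
      \<open>j\<close>.\<close>
    define j where "j = (LEAST j. j \<ge> 1 \<and> g j \<noteq> G j)"
    have j: "j \<ge> 1" "g j \<noteq> G j"
      using LeastI[of "\<lambda>j. j \<ge> 1 \<and> g j \<noteq> G j" k] \<open>g k \<noteq> G k\<close> k by (auto simp: j_def)
    have "j \<le> k"
      using Least_le[of "\<lambda>j. j \<ge> 1 \<and> g j \<noteq> G j" k] \<open>g k \<noteq> G k\<close> k by (auto simp: j_def)
    have "g i = G i" if "i \<in> {1..<j}" for i
      using that not_less_Least[of i "\<lambda>j. j \<ge> 1 \<and> g j \<noteq> G j"] by (auto simp: j_def)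
    with j g have "g \<in> wrong j"
      by (auto simp: wrong_def candidates_def K_def)
    then have "score C Y j K g \<le> (\<rho> ^ n) ^ (Suc K - j)"
      using j \<open>j \<le> k\<close> by (intro notB) auto
    moreover have "score C Y j K g > (\<rho> ^ n) ^ (Suc K - j)"
      using g j \<open>j \<le> k\<close> unfolding candidates_def K_def[symmetric] K(3) by simp
    ultimately show False
      by simp
  qed
  then have "emeasure (joint G) {(C, Y). decode C k Y \<noteq> G k} \<le>
      emeasure (joint G) (\<Union>j\<in>{1..k}. A j \<union> (\<Union>g\<in>wrong j. B j g))"
    by (intro emeasure_mono) auto
  also have "\<dots> \<le> (\<Sum>j\<in>{1..k}. emeasure (joint G) (A j \<union> (\<Union>g\<in>wrong j. B j g)))"
    by (intro emeasure_subadditive_finite) auto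
  also have "\<dots> \<le> (\<Sum>j\<in>{1..k}. ennreal (2 * c ^ (k + T - j)))"
  proof (intro sum_mono)
    fix j assume j: "j \<in> {1..k}"
    let ?L = "Suc K - j"
    have "emeasure (joint G) (\<Union>g\<in>wrong j. B j g) \<le> (\<Sum>g\<in>wrong j. emeasure (joint G) (B j g))"
      using finite_wrong by (intro emeasure_subadditive_finite) auto
    also have "\<dots> \<le> (\<Sum>g\<in>wrong j. ennreal (1 / (\<rho> ^ n) ^ ?L))"
      unfolding B_def using j K k G
      by (intro sum_mono prob_wrong_score_gt) (auto simp: wrong_def)
    also have "\<dots> = ennreal (real (card (wrong j)) / (\<rho> ^ n) ^ ?L)"
      using rho_pos by (simp add: ennreal_of_nat_eq_real_of_nat flip: ennreal_mult)
    also have "\<dots> \<le> ennreal (c ^ ?L)"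
    proof (rule ennreal_leI)
      have "card (wrong j) \<le> card {g \<in> {1..min K S} \<rightarrow>\<^sub>E {1..M}. \<forall>i\<in>{1..<j}. g i = G i}"
        by (intro card_mono) (auto simp: wrong_def intro!: finite_subset[of _ "{1..min K S} \<rightarrow>\<^sub>E {1..M}"] finite_PiE)
      also have "\<dots> \<le> M ^ ?L"
        using j K by (intro card_common_prefix_le) auto
      finally have "real (card (wrong j)) \<le> real M ^ ?L"
        by (metis of_nat_le_iff of_nat_power)
      also have "\<dots> \<le> (c * \<rho> ^ n) ^ ?L"
        using count_le by (intro power_mono) auto
      finally show "real (card (wrong j)) / (\<rho> ^ n) ^ ?L \<le> c ^ ?L"
        using rho_pos by (simp add: divide_le_eq power_mult_distrib)
    qed
    finally have wrong_le: "emeasure (joint G) (\<Union>g\<in>wrong j. B j g) \<le> ennreal (c ^ ?L)" .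
    have true_le: "emeasure (joint G) (A j) \<le> ennreal (c ^ ?L)"
      unfolding A_def using j K k G by (intro prob_true_score_le) auto
    have "emeasure (joint G) (A j \<union> (\<Union>g\<in>wrong j. B j g)) \<le>
        emeasure (joint G) (A j) + emeasure (joint G) (\<Union>g\<in>wrong j. B j g)"
      by (intro emeasure_subadditive) auto
    also have "\<dots> \<le> ennreal (c ^ ?L) + ennreal (c ^ ?L)"
      by (intro add_mono true_le wrong_le)
    also have "\<dots> = ennreal (2 * c ^ (k + T - j))"
      unfolding K(3) using c_pos by (simp flip: ennreal_plus)
    finally show "emeasure (joint G) (A j \<union> (\<Union>g\<in>wrong j. B j g)) \<le> ennreal (2 * c ^ (k + T - j))" .
  qed
  also have "\<dots> = ennreal (2 * (\<Sum>j=1..k. c ^ (k + T - j)))"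
    using c_pos by (simp add: sum_ennreal sum_distrib_left)
  also have "\<dots> \<le> ennreal (4 * c ^ T)"
    using sum_power_tail_le[of c k T] c_pos c_le by (intro ennreal_leI) auto
  finally show ?thesis .
qed

section \<open>From the random ensemble to one code\<close>

lemma decode_restrict:
  "decode C k (restrict Y {1..k + T - 1}) = decode C k Y"
proof -
  have "score C (restrict Y {1..k + T - 1}) j (k + T - 1) g = score C Y j (k + T - 1) g" if "j \<in> {1..k}" for j g
    unfolding score_def by (intro prod.cong refl) (use that in auto)
  then have "candidates C (restrict Y {1..k + T - 1}) k = candidates C Y k"
    by (auto simp: candidates_def)
  then show ?thesis
    by (simp add: decode_def)
qed

lemma decode_range:
  assumes "k \<in> {1..S}"
  shows "decode C k Y \<in> {1..M}"
proof (cases "candidates C Y k = {}")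
  case False
  then have "(SOME g. g \<in> candidates C Y k) \<in> candidates C Y k"
    by (simp add: some_in_eq)
  then have "(SOME g. g \<in> candidates C Y k) k \<in> {1..M}"
    using assms T_pos by (auto simp: candidates_def)
  with False show ?thesis
    by (simp add: decode_def)
qed (use M_pos in \<open>simp add: decode_def\<close>)

lemma ennreal_stream_error:
  "ennreal (stream_error W n M T S (\<lambda>l g i. C (l, g, i)) (decode C) k) =
     (\<integral>\<^sup>+G. emeasure (outputs C G) {Y. decode C k Y \<noteq> G k} \<partial>message_pmf M S)"
  unfolding stream_error_def measure_pmf.emeasure_eq_measure[symmetric] stream_pmf_def decode_restrict
  by (simp add: outputs_def pos_def vimage_def)

lemma expected_error_le:
  assumes "k \<in> {1..S}"
  shows "(\<integral>\<^sup>+C. ennreal (stream_error W n M T S (\<lambda>l g i. C (l, g, i)) (decode C) k) \<partial>codebook) \<le> ennreal (4 * c ^ T)"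
proof -
  have "(\<integral>\<^sup>+C. ennreal (stream_error W n M T S (\<lambda>l g i. C (l, g, i)) (decode C) k) \<partial>codebook) =
      (\<integral>\<^sup>+G. \<integral>\<^sup>+C. emeasure (outputs C G) {Y. decode C k Y \<noteq> G k} \<partial>codebook \<partial>message_pmf M S)"
    unfolding ennreal_stream_error by (rule nn_integral_swap_pmf)
  also have "\<dots> = (\<integral>\<^sup>+G. emeasure (joint G) {(C, Y). decode C k Y \<noteq> G k} \<partial>message_pmf M S)"
    by (simp add: joint_def vimage_def)
  also have "\<dots> \<le> (\<integral>\<^sup>+G. ennreal (4 * c ^ T) \<partial>message_pmf M S)"
    using M_pos assms
    by (intro nn_integral_mono_AE AE_pmfI prob_decoding_error_le)
      (auto simp: message_pmf_def set_Pi_pmf PiE_dflt_def)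
  finally show ?thesis
    by simp
qed

text \<open>One codebook must serve all \<open>k\<close>, so the sum of the errors is averaged. Its
  mean is at most half of the bound; the factor 2 yields a contradiction without a strict inequality
  between integrals.\<close>

theorem exists_streaming_code:
  "\<exists>\<phi> \<psi>. streaming_code W n M (8 * real S * c ^ T) T S \<phi> \<psi>"
proof -
  define err where "err = (\<lambda>C k. stream_error W n M T S (\<lambda>l g i. C (l, g, i)) (decode C) k)"
  have err_nonneg: "err C k \<ge> 0" for C k
    by (simp add: err_def stream_error_def)
  have bound_pos: "8 * real S * c ^ T > 0"
    using S_pos c_pos by simp
  have "\<exists>C. (\<Sum>k\<in>{1..S}. err C k) < 8 * real S * c ^ T"
  proof (rule ccontr)
    assume "\<nexists>C. (\<Sum>k\<in>{1..S}. err C k) < 8 * real S * c ^ T"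
    then have ge: "8 * real S * c ^ T \<le> (\<Sum>k\<in>{1..S}. err C k)" for C
      by (auto simp: not_less)
    have "ennreal (8 * real S * c ^ T) = (\<integral>\<^sup>+C. ennreal (8 * real S * c ^ T) \<partial>codebook)"
      by simp
    also have "\<dots> \<le> (\<integral>\<^sup>+C. ennreal (\<Sum>k\<in>{1..S}. err C k) \<partial>codebook)"
      using ge by (intro nn_integral_mono ennreal_leI)
    also have "\<dots> = (\<Sum>k\<in>{1..S}. \<integral>\<^sup>+C. ennreal (err C k) \<partial>codebook)"
      by (simp add: err_nonneg nn_integral_sum flip: sum_ennreal)
    also have "\<dots> \<le> (\<Sum>k\<in>{1..S}. ennreal (4 * c ^ T))"
      unfolding err_def by (intro sum_mono expected_error_le)
    also have "\<dots> = ennreal (4 * real S * c ^ T)"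
      using c_pos by (simp add: ennreal_of_nat_eq_real_of_nat mult_ac flip: ennreal_mult)
    finally show False
      using bound_pos by (simp add: ennreal_le_iff2)
  qed
  then obtain C where C: "(\<Sum>k\<in>{1..S}. err C k) < 8 * real S * c ^ T"
    by blast
  have "err C k \<le> 8 * real S * c ^ T" if "k \<in> {1..S}" for k
    using member_le_sum[of k "{1..S}" "err C"] that C err_nonneg by auto
  then have "streaming_code W n M (8 * real S * c ^ T) T S (\<lambda>l g i. C (l, g, i)) (decode C)"
    using n_pos M_pos T_pos S_pos decode_range
    by (auto simp: streaming_code_def err_def)
  then show ?thesis
    by blast
qed

end

subsection \<open>Moderate deviations\<close>

text \<open>The exponent \<open>\<sigma> / ln 2\<close> converts powers of 2 into
  \<open>exp\<close>, so each term becomes \<open>exp (- \<sigma> * \<delta>)\<close> times the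
  exponential moment of the centered density.\<close>

lemma likelihood_ratio_mgf_le:
  fixes W :: "'x::finite \<Rightarrow> 'y::finite pmf"
  assumes P: "mutual_info P W = capacity W" and v: "cond_info_variance P W \<le> v"
    and \<sigma>: "\<And>x y. \<bar>\<sigma> * (info_density P W x y - capacity W)\<bar> \<le> 1/25"
  shows "(\<Sum>x\<in>UNIV. \<Sum>y\<in>UNIV. pmf P x * pmf (W x) y *
      (2 powr (capacity W - \<delta>) / likelihood_ratio P W x y) powr (\<sigma> / ln 2)) \<le>
    exp (21/40 * \<sigma>\<^sup>2 * v - \<sigma> * \<delta>)"
proof -
  define w where "w = (\<lambda>(x, y). pmf P x * pmf (W x) y)"
  define Z where "Z = (\<lambda>(x, y). info_density P W x y - capacity W)"
  have total: "sum w UNIV = 1"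
    by (simp add: w_def sum_pmf_UNIV flip: UNIV_Times_UNIV sum.cartesian_product sum_distrib_left)
  have "(\<Sum>z\<in>UNIV. w z * info_density P W (fst z) (snd z)) = capacity W"
    by (simp add: w_def P[symmetric] mutual_info_def case_prod_unfold sum.cartesian_product flip: UNIV_Times_UNIV)
  then have mean: "(\<Sum>z\<in>UNIV. w z * Z z) = 0"
    using total by (simp add: Z_def case_prod_unfold right_diff_distrib sum_subtractf flip: sum_distrib_right)
  have "(\<Sum>z\<in>UNIV. w z * (Z z)\<^sup>2) = cond_info_variance P W"
    by (simp add: w_def Z_def capacity_achieving_second_moment[OF P, symmetric] case_prod_unfold sum.cartesian_product
        flip: UNIV_Times_UNIV)
  then have "(\<Sum>z\<in>UNIV. w z * exp (- \<sigma> * Z z)) \<le> exp (21/40 * \<sigma>\<^sup>2 * v)"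
    using total mean v \<sigma> by (intro centered_mgf_bound) (auto simp: w_def Z_def)
  then have "exp (- \<sigma> * \<delta>) * (\<Sum>z\<in>UNIV. w z * exp (- \<sigma> * Z z)) \<le> exp (- \<sigma> * \<delta>) * exp (21/40 * \<sigma>\<^sup>2 * v)"
    by (intro mult_left_mono) auto
  also have "exp (- \<sigma> * \<delta>) * exp (21/40 * \<sigma>\<^sup>2 * v) = exp (21/40 * \<sigma>\<^sup>2 * v - \<sigma> * \<delta>)"
    by (simp flip: exp_add)
  also have "exp (- \<sigma> * \<delta>) * (\<Sum>z\<in>UNIV. w z * exp (- \<sigma> * Z z)) =
      (\<Sum>z\<in>UNIV. w z * (2 powr (capacity W - \<delta>) / likelihood_ratio P W (fst z) (snd z)) powr (\<sigma> / ln 2))"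
    unfolding sum_distrib_left
  proof (intro sum.cong refl)
    fix z :: "'x \<times> 'y"
    obtain x y where z: "z = (x, y)"
      by (cases z)
    show "exp (- \<sigma> * \<delta>) * (w z * exp (- \<sigma> * Z z)) =
        w z * (2 powr (capacity W - \<delta>) / likelihood_ratio P W (fst z) (snd z)) powr (\<sigma> / ln 2)"
    proof (cases "x \<in> set_pmf P \<and> y \<in> set_pmf (W x)")
      case True
      then have r: "likelihood_ratio P W x y > 0"
        by (intro likelihood_ratio_pos) auto
      then have "likelihood_ratio P W x y = 2 powr info_density P W x y"
        by (simp add: info_density_def likelihood_ratio_def)
      then have "2 powr (capacity W - \<delta>) / likelihood_ratio P W x y = 2 powr (capacity W - \<delta> - info_density P W x y)"
        by (simp flip: powr_diff)
      also have "capacity W - \<delta> - info_density P W x y = - \<delta> - Z z"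
        by (simp add: z Z_def)
      finally have "2 powr (capacity W - \<delta>) / likelihood_ratio P W x y = 2 powr (- \<delta> - Z z)" .
      then have "(2 powr (capacity W - \<delta>) / likelihood_ratio P W x y) powr (\<sigma> / ln 2) =
          2 powr ((- \<delta> - Z z) * (\<sigma> / ln 2))"
        by (simp add: powr_powr)
      also have "\<dots> = exp ((- \<delta> - Z z) * \<sigma>)"
        by (simp add: powr_def)
      also have "\<dots> = exp (- \<sigma> * \<delta>) * exp (- \<sigma> * Z z)"
        by (simp add: algebra_simps flip: exp_add)
      finally show ?thesis
        by (simp add: z)
    qed (auto simp: z w_def set_pmf_iff)
  qed
  finally show ?thesis
    by (simp add: w_def case_prod_unfold sum.cartesian_product flip: UNIV_Times_UNIV)
qed

text \<open>Rounding up costs at most one bit once the unrounded count is at least 1.\<close>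

lemma message_count_le:
  assumes "real n powr (1 - t) \<le> real n * capacity W"
  shows "real (message_count W t n) \<le> 2 * 2 powr (real n * capacity W - real n powr (1 - t))"
proof -
  let ?a = "2 powr (real n * capacity W - real n powr (1 - t))"
  have "1 \<le> ?a"
    using assms by (simp add: ge_one_powr_ge_zero)
  moreover have "real (message_count W t n) \<le> ?a + 1"
    using of_int_ceiling_le_add_one[of ?a] by (simp add: message_count_def)
  ultimately show ?thesis
    by linarith
qed

lemma message_count_pos: "message_count W t n > 0"
  by (simp add: message_count_def)

lemma streaming_code_mono:
  "streaming_code W n M \<epsilon> T S \<phi> \<psi> \<Longrightarrow> \<epsilon> \<le> \<epsilon>' \<Longrightarrow> streaming_code W n M \<epsilon>' T S \<phi> \<psi>"
  unfolding streaming_code_def by (blast intro: order_trans)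

text \<open>Covers the block lengths not reached by the asymptotic construction.\<close>

lemma trivial_streaming_code:
  assumes "n > 0" "M > 0" "T > 0" "S > 0"
  shows "streaming_code W n M 1 T S (\<lambda>_ _ _. undefined) (\<lambda>_ _. 1)"
  using assms by (auto simp: streaming_code_def stream_error_def)

text \<open>
  With \<open>\<delta> = 19/20 n\<^bsup>-t\<^esup>\<close> and \<open>\<sigma> = n\<^bsup>-t\<^esup> / \<nu>\<close> the Chernoff exponent of one block
  is \<open>0.39\<dots> n\<^bsup>1-2t\<^esup> / \<nu>\<close> in nats. This is more than \<open>0.56 n\<^bsup>1-2t\<^esup> / \<nu>\<close> in bits, which leaves
  room above the exponent \<open>n\<^bsup>1-2t\<^esup> / (2\<nu>)\<close> to absorb the constants and the factor \<open>S\<close>.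
\<close>
lemma eventually_streaming_code:
  fixes W :: "'x::finite \<Rightarrow> 'y::finite pmf" and S :: "nat \<Rightarrow> nat"
  assumes \<nu>: "dispersion W > 0" and T: "T \<ge> 1" and t: "0 < t" "t < 1/2"
    and S_pos: "\<And>n. n \<ge> 1 \<Longrightarrow> S n > 0"
    and S_o: "(\<lambda>n. log 2 (real (S n))) \<in> o(\<lambda>n. real n powr (1 - 2 * t))"
  shows "\<forall>\<^sub>F n in sequentially. \<exists>\<phi> \<psi>. streaming_code W n (message_count W t n)
    (2 powr - (real T / (2 * dispersion W) * real n powr (1 - 2 * t))) T (S n) \<phi> \<psi>"
proof -
  define \<nu> where "\<nu> = dispersion W"
  have nu: "\<nu> > 0"
    using assms by (simp add: \<nu>_def)
  define Cap where "Cap = capacity W"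
  have Cap: "Cap > 0"
    using capacity_pos[OF \<open>dispersion W > 0\<close>] by (simp add: Cap_def)
  obtain P where P: "mutual_info P W = capacity W" and V: "cond_info_variance P W < 21/20 * \<nu>"
    using exists_near_dispersion[of W "21/20 * \<nu>"] nu by (auto simp: \<nu>_def)
  define B where "B = 1 + (\<Sum>x\<in>UNIV. \<Sum>y\<in>UNIV. \<bar>info_density P W x y - capacity W\<bar>)"
  have B: "\<bar>info_density P W x y - capacity W\<bar> \<le> B" for x y
  proof -
    have "\<bar>info_density P W x y - capacity W\<bar> \<le> (\<Sum>y\<in>UNIV. \<bar>info_density P W x y - capacity W\<bar>)"
      by (intro member_le_sum) auto
    also have "\<dots> \<le> (\<Sum>x\<in>UNIV. \<Sum>y\<in>UNIV. \<bar>info_density P W x y - capacity W\<bar>)"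
      by (intro member_le_sum[where f = "\<lambda>x. \<Sum>y\<in>UNIV. \<bar>info_density P W x y - capacity W\<bar>"] sum_nonneg) auto
    also have "\<dots> \<le> B"
      by (simp add: B_def)
    finally show ?thesis .
  qed
  have B_pos: "B > 0"
    unfolding B_def by (intro add_pos_nonneg sum_nonneg) auto
  \<comment> \<open>The conditions after \<open>n \<ge> 1\<close> ensure, in order: a nonnegative
    message exponent; the range of the quadratic bound; room for the rounding bit and the block
    exponent between rate and threshold; \<open>c \<le> 1/2\<close>; absorption of the factor 8,
    that is 3 bits; absorption of \<open>S n\<close>.\<close>
  have "\<forall>\<^sub>F n in sequentially. n \<ge> 1"
    by (rule eventually_ge_at_top)
  moreover have "\<forall>\<^sub>F n in sequentially. real n powr (1 - t) \<le> real n * Cap"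
    using t Cap by real_asymp
  moreover have "\<forall>\<^sub>F n in sequentially. real n powr (- t) / \<nu> * B \<le> 1/25"
    using t nu B_pos by real_asymp
  moreover have "\<forall>\<^sub>F n in sequentially. 1 + 14/25 * real n powr (1 - 2 * t) / \<nu> \<le> real n powr (1 - t) / 20"
    using t nu by real_asymp
  moreover have "\<forall>\<^sub>F n in sequentially. 1 \<le> 14/25 * real n powr (1 - 2 * t) / \<nu>"
    using t nu by real_asymp
  moreover have "\<forall>\<^sub>F n in sequentially. 3 \<le> 1/50 * real n powr (1 - 2 * t) / \<nu>"
    using t nu by real_asymp
  moreover have "\<forall>\<^sub>F n in sequentially. norm (log 2 (real (S n))) \<le> 1 / (25 * \<nu>) * norm (real n powr (1 - 2 * t))"
    using landau_o.smallD[OF S_o, of "1 / (25 * \<nu>)"] nu by simp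
  ultimately show ?thesis
  proof eventually_elim
    case (elim n)
    define u where "u = real n powr (1 - 2 * t)"
    define \<sigma> where "\<sigma> = real n powr (- t) / \<nu>"
    define \<delta> where "\<delta> = 19/20 * real n powr (- t)"
    define c where "c = 2 powr - (14/25 * u / \<nu>)"
    define \<rho> where "\<rho> = 2 powr (capacity W - \<delta>)"
    have n: "n > 0" and Sn: "S n > 0"
      using elim(1) S_pos by auto
    have n_t: "real n * real n powr (- t) = real n powr (1 - t)"
      using n by (simp add: powr_mult_base)
    have n_2t: "real n * (real n powr (- t))\<^sup>2 = u"
    proof -
      have "(real n powr (- t))\<^sup>2 = real n powr (- 2 * t)"
        by (simp add: power2_eq_square flip: powr_add)
      then show ?thesis
        using n by (simp add: u_def powr_mult_base)
    qed
    have u_nonneg: "u \<ge> 0"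
      by (simp add: u_def)
    have rho_n: "\<rho> ^ n = 2 powr (real n * Cap - 19/20 * real n powr (1 - t))"
      unfolding \<rho>_def by (simp add: powr_power \<delta>_def Cap_def right_diff_distrib mult_ac flip: n_t)
    interpret random_streaming_code W P n "message_count W t n" T "S n" \<rho> "\<sigma> / ln 2" c
    proof
      show "n > 0" "message_count W t n > 0" "T > 0" "S n > 0" "\<rho> > 0" "\<sigma> / ln 2 \<ge> 0" "c > 0"
        using n Sn T nu message_count_pos[of W t n] by (auto simp: \<rho>_def \<sigma>_def c_def)
      have "c \<le> 2 powr - 1"
        unfolding c_def using elim(5) by (intro powr_mono) (auto simp: u_def)
      then show "c \<le> 1/2"
        by (simp add: powr_minus)
      have "real (message_count W t n) \<le> 2 * 2 powr (real n * Cap - real n powr (1 - t))"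
        using message_count_le[of n t W] elim(2) by (simp add: Cap_def)
      also have "\<dots> = 2 powr (1 + (real n * Cap - real n powr (1 - t)))"
        by (simp add: powr_add)
      also have "\<dots> \<le> 2 powr (- (14/25 * u / \<nu>) + (real n * Cap - 19/20 * real n powr (1 - t)))"
        using elim(4) by (intro powr_mono) (auto simp: u_def)
      also have "\<dots> = c * \<rho> ^ n"
        by (simp only: powr_add c_def rho_n)
      finally show "real (message_count W t n) \<le> c * \<rho> ^ n" .
      let ?m = "\<Sum>x\<in>UNIV. \<Sum>y\<in>UNIV. pmf P x * pmf (W x) y * (\<rho> / likelihood_ratio P W x y) powr (\<sigma> / ln 2)"
      have "?m \<le> exp (21/40 * \<sigma>\<^sup>2 * (21/20 * \<nu>) - \<sigma> * \<delta>)"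
        unfolding \<rho>_def
      proof (rule likelihood_ratio_mgf_le[OF P less_imp_le[OF V]])
        fix x y
        have "\<bar>\<sigma> * (info_density P W x y - capacity W)\<bar> = \<sigma> * \<bar>info_density P W x y - capacity W\<bar>"
          using nu by (simp add: \<sigma>_def abs_mult)
        also have "\<dots> \<le> \<sigma> * B"
          using nu B by (intro mult_left_mono) (auto simp: \<sigma>_def)
        also have "\<dots> \<le> 1/25"
          using elim(3) by (simp add: \<sigma>_def)
        finally show "\<bar>\<sigma> * (info_density P W x y - capacity W)\<bar> \<le> 1/25" .
      qed
      then have "?m ^ n \<le> exp (21/40 * \<sigma>\<^sup>2 * (21/20 * \<nu>) - \<sigma> * \<delta>) ^ n"
        by (intro power_mono sum_nonneg) auto
      also have "\<dots> = exp (real n * (21/40 * \<sigma>\<^sup>2 * (21/20 * \<nu>) - \<sigma> * \<delta>))"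
        by (simp add: exp_of_nat_mult)
      also have "\<dots> \<le> exp (- (14/25 * (u / \<nu>) * ln 2))"
      proof -
        \<comment> \<open>Here 319/800 is 19/20 minus the product of 21/40 and 21/20.\<close>
        have "real n * (21/40 * \<sigma>\<^sup>2 * (21/20 * \<nu>) - \<sigma> * \<delta>) = - (319/800 * (real n * (real n powr (- t))\<^sup>2) / \<nu>)"
          using nu by (simp add: \<sigma>_def \<delta>_def power2_eq_square field_simps)
        also have "\<dots> = - (319/800 * (u / \<nu>))"
          by (simp add: n_2t)
        finally have "real n * (21/40 * \<sigma>\<^sup>2 * (21/20 * \<nu>) - \<sigma> * \<delta>) = - (319/800 * (u / \<nu>))" .
        \<comment> \<open>Conversion from nats to bits: 14/25 times 25/36 is 7/18, below
          319/800.\<close>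
        moreover have "14/25 * q * ln 2 \<le> 319/800 * q" if "q \<ge> 0" for q :: real
          using mult_left_mono[OF ln2_le_25_over_36 that] that by simp
        from this[of "u / \<nu>"] have "14/25 * (u / \<nu>) * ln 2 \<le> 319/800 * (u / \<nu>)"
          using u_nonneg nu by simp
        ultimately show ?thesis
          by simp
      qed
      also have "\<dots> = c"
        by (simp add: c_def powr_def)
      finally show "?m ^ n \<le> c" .
    qed
    obtain \<phi> \<psi> where code: "streaming_code W n (message_count W t n) (8 * real (S n) * c ^ T) T (S n) \<phi> \<psi>"
      using exists_streaming_code by blast
    have "8 * real (S n) * c ^ T = 2 powr (3 + log 2 (real (S n)) - 14/25 * (real T * (u / \<nu>)))"
    proof -
      have "c ^ T = 2 powr - (14/25 * (real T * (u / \<nu>)))"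
        by (simp add: c_def powr_power mult_ac)
      moreover have "(2::real) powr 3 = 8" "2 powr log 2 (real (S n)) = real (S n)"
        using Sn by auto
      ultimately show ?thesis
        by (simp only: powr_add diff_conv_add_uminus)
    qed
    also have "\<dots> \<le> 2 powr - (1/2 * (real T * (u / \<nu>)))"
    proof (rule powr_mono)
      \<comment> \<open>The two overheads add up to 3/50, exactly the gap between 14/25 and 1/2;
        \<open>T \<ge> 1\<close> makes the gap at least this large.\<close>
      have "log 2 (real (S n)) \<le> 1/25 * (u / \<nu>)" "3 \<le> 1/50 * (u / \<nu>)"
        using elim(6,7) by (auto simp: u_def)
      moreover have "1 * (u / \<nu>) \<le> real T * (u / \<nu>)"
        using T u_nonneg nu by (intro mult_right_mono) auto
      ultimately show "3 + log 2 (real (S n)) - 14/25 * (real T * (u / \<nu>)) \<le> - (1/2 * (real T * (u / \<nu>)))"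
        by linarith
    qed simp
    also have "- (1/2 * (real T * (u / \<nu>))) = - (real T / (2 * dispersion W) * real n powr (1 - 2 * t))"
      by (simp add: \<nu>_def u_def)
    finally show ?case
      using streaming_code_mono[OF code] by blast
  qed
qed

theorem proposition3:
  fixes W :: "'x::finite \<Rightarrow> 'y::finite pmf" and T :: nat and t :: real and S :: "nat \<Rightarrow> nat"
  assumes "dispersion W > 0"
    and "T \<ge> 1"
    and "0 < t" and "t < 1 / 2"
    and "\<forall>n\<ge>1. log 2 (real (S n)) > 0"
    and "(\<lambda>n. log 2 (real (S n))) \<in> o(\<lambda>n. real n powr (1 - 2 * t))"
  shows "\<exists>(M :: nat \<Rightarrow> nat) (\<epsilon> :: nat \<Rightarrow> real)
            (\<phi> :: nat \<Rightarrow> 'x stream_encoder) (\<psi> :: nat \<Rightarrow> 'y stream_decoder).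
           (\<forall>n\<ge>1. streaming_code W n (M n) (\<epsilon> n) T (S n) (\<phi> n) (\<psi> n) \<and>
                  M n = message_count W t n \<and> \<epsilon> n > 0) \<and>
           liminf (\<lambda>n. ereal (- (1 / real n powr (1 - 2 * t)) * log 2 (\<epsilon> n)))
             \<ge> ereal (real T / (2 * dispersion W))"
proof -
  define \<epsilon>\<^sub>0 where "\<epsilon>\<^sub>0 = (\<lambda>n. 2 powr - (real T / (2 * dispersion W) * real n powr (1 - 2 * t)))"
  define good where "good = (\<lambda>n. \<exists>\<phi> \<psi>. streaming_code W n (message_count W t n) (\<epsilon>\<^sub>0 n) T (S n) \<phi> \<psi>)"
  \<comment> \<open>All but finitely many \<open>n\<close> are good, so the value 1 elsewhere does
    not affect the limit inferior.\<close>
  define \<epsilon> where "\<epsilon> = (\<lambda>n. if good n then \<epsilon>\<^sub>0 n else 1)"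
  \<comment> \<open>Since \<open>log 2 0 = 0\<close>, positivity of the logarithm rules out
    \<open>S n = 0\<close>.\<close>
  have S_pos: "S n > 0" if "n \<ge> 1" for n
    using assms(5) that by (cases "S n = 0") (auto simp: log_def)
  have "\<exists>\<phi> \<psi>. streaming_code W n (message_count W t n) (\<epsilon> n) T (S n) \<phi> \<psi>" if "n \<ge> 1" for n
  proof (cases "good n")
    case True
    then show ?thesis
      by (simp add: \<epsilon>_def) (simp add: good_def)
  next
    case False
    with trivial_streaming_code[of n "message_count W t n" T "S n" W] that assms(2) S_pos message_count_pos[of W t n]
    show ?thesis
      by (auto simp: \<epsilon>_def)
  qed
  then obtain \<phi> \<psi> where code: "\<And>n. n \<ge> 1 \<Longrightarrow> streaming_code W n (message_count W t n) (\<epsilon> n) T (S n) (\<phi> n) (\<psi> n)"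
    by metis
  have "\<forall>\<^sub>F n in sequentially. good n"
    unfolding good_def \<epsilon>\<^sub>0_def by (intro eventually_streaming_code assms S_pos)
  moreover have "\<forall>\<^sub>F n in sequentially. n \<ge> (1::nat)"
    by (rule eventually_ge_at_top)
  ultimately have "\<forall>\<^sub>F n in sequentially. ereal (real T / (2 * dispersion W)) \<le>
      ereal (- (1 / real n powr (1 - 2 * t)) * log 2 (\<epsilon> n))"
  proof eventually_elim
    case (elim n)
    then show ?case
      by (simp add: \<epsilon>_def \<epsilon>\<^sub>0_def)
  qed
  then have "liminf (\<lambda>n. ereal (- (1 / real n powr (1 - 2 * t)) * log 2 (\<epsilon> n))) \<ge> ereal (real T / (2 * dispersion W))"
    by (rule Liminf_bounded)
  moreover have "\<epsilon> n > 0" for n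
    by (simp add: \<epsilon>_def \<epsilon>\<^sub>0_def)
  ultimately show ?thesis
    using code by (intro exI[of _ "message_count W t"] exI[of _ \<epsilon>] exI[of _ \<phi>] exI[of _ \<psi>]) auto
qed

end
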